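(* Each of the spaces $V^0,W^2,\dots,W^n$ is stable under all the matrices $R_k$, $k\in\{2,\dots,n-1\}$; it is thus a direct sum of their (simultaneous) eigenspaces. In addition, $$\ker R_k=\bigoplus_{j=k+1}^nW^j\qquad\text{for all }k\in\{2,\dots,n-1\}.$$
   Context: Let $n\ge 3$, $[n]=\{1,\dots,n\}$, and let $L(\mathfrak S_n)$ be the space of real functions on the symmetric group $\mathfrak S_n$ with its canonical inner product $\langle f,g\rangle=\sum_\sigma f(\sigma)g(\sigma)$. An injective word is a finite sequence of distinct elements of $[n]$; $\Gamma^k$ is the set of injective words of length $k$. A permutation $\sigma$ is identified with the word of length $n$ $\sigma^{-1}(1)\sigma^{-1}(2)\cdots\sigma^{-1}(n)$ (the ranking of all items). For an injective word $\pi$, $\pi\subset\sigma$ means that $\pi$ is a (not necessarily contiguous) subword of $\sigma$, and $\mathfrak S_n(\pi)=\{\sigma\in\mathfrak S_n:\pi\subset\sigma\}$. $\mathbf 1_S$ is the indicator of $S$. $V^0=\mathbb R\mathbf 1_{\mathfrak S_n}$, and for $k\in\{2,\dots,n\}$, $V^k=\operatorname{span}\{\mathbf 1_{\mathfrak S_n(\pi)}:\pi\in\Gamma^k\}$. One has $V^0\subset V^2\subset\dots\subset V^n=L(\mathfrak S_n)$. $W^2$ is the orthogonal complement of $V^0$ in $V^2$, and for $k\in\{3,\dots,n\}$, $W^k$ is the orthogonal complement of $V^{k-1}$ in $V^k$. For $k\in\{2,\dots,n-1\}$, $R_k$ is the transition matrix, acting on $L(\mathfrak S_n)$, of the $(n-k)$-random-to-random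 shuffle: from a deck of $n$ cards in configuration $\sigma$, pick $n-k$ cards uniformly at random and reinsert them at uniformly random positions and in random order, so that the new configuration is uniform over $\mathfrak S_n(\pi)$, where $\pi$ is the word formed by the $k$ remaining cards. Explicitly, $R_kf=(n-k)!\left(\frac{k!}{n!}\right)^2\sum_{\pi\in\Gamma^k}\langle f,\mathbf 1_{\mathfrak S_n(\pi)}\rangle\mathbf 1_{\mathfrak S_n(\pi)}$. The matrices $R_2,\dots,R_{n-1}$ are symmetric positive semidefinite and pairwise commute, hence are simultaneously diagonalizable; a simultaneous eigenspace is a nonzero subspace of the form $\bigcap_{k=2}^{n-1}\ker(R_k-\mu_k\,\mathrm{Id})$. *)

theory Defs
  imports "HOL-Analysis.Analysis" "HOL-Combinatorics.Perm" "HOL-Library.Sublist"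
begin

unbundle permutation_syntax

text \<open>
  The set \<open>[n]\<close> is a type \<open>'n\<close> of class \<open>{finite, linorder}\<close> with \<open>n = CARD('n)\<close>; the order only serves
  to read the elements of \<open>[n]\<close> as the positions \<open>1, ..., n\<close>.  On a finite type, \<open>'n perm\<close> is
  the full symmetric group, so that the space of real functions on it, with its canonical inner
  product, is \<open>real ^ ('n perm)\<close>.
\<close>

instance perm :: (finite) finite
proof
  have "inj (apply :: 'a perm \<Rightarrow> 'a \<Rightarrow> 'a)"
    by (simp add: inj_def apply_inject)
  then show "finite (UNIV :: 'a perm set)"
    by (rule finite_imageD[rotated]) (rule finite_subset[OF subset_UNIV], simp)
qed

definition perm_word :: "'n::{finite,linorder} perm \<Rightarrow> 'n list" where
  "perm_word \<sigma> = map (apply (inverse \<sigma>)) (sorted_list_of_set UNIV)"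

definition inj_words :: "nat \<Rightarrow> 'n list set" where
  "inj_words k = {\<pi>. distinct \<pi> \<and> length \<pi> = k}"

definition perms_containing :: "'n list \<Rightarrow> 'n::{finite,linorder} perm set" where
  "perms_containing \<pi> = {\<sigma>. subseq \<pi> (perm_word \<sigma>)}"

definition ind_vec :: "'a set \<Rightarrow> real ^ 'a::finite" where
  "ind_vec S = (\<chi> \<sigma>. indicator S \<sigma>)"

text \<open>The value at \<open>k = 1\<close> is never used.\<close>
definition V_space :: "nat \<Rightarrow> (real ^ ('n::{finite,linorder} perm)) set" where
  "V_space k =
     (if k = 0 then span {ind_vec UNIV}
      else span {ind_vec (perms_containing \<pi>) | \<pi>. \<pi> \<in> inj_words k})"

text \<open>Meaningful for \<open>k \<ge> 2\<close> only; the space \<open>V_space 1\<close> is skipped.\<close>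
definition W_space :: "nat \<Rightarrow> (real ^ ('n::{finite,linorder} perm)) set" where
  "W_space k = V_space k \<inter> orthogonal_comp (V_space (if k = 2 then 0 else k - 1))"

definition R_mat ::
  "nat \<Rightarrow> real ^ ('n::{finite,linorder} perm) \<Rightarrow> real ^ ('n perm)" where
  "R_mat k f =
     (fact (CARD('n) - k) * (fact k / fact CARD('n))\<^sup>2) *\<^sub>R
     (\<Sum>\<pi>\<in>inj_words k. (f \<bullet> ind_vec (perms_containing \<pi>)) *\<^sub>R ind_vec (perms_containing \<pi>))"

definition simultaneous_eigenspaces :: "(real ^ ('n::{finite,linorder} perm)) set set" where
  "simultaneous_eigenspaces =
     {S. S \<noteq> {0} \<and> (\<exists>\<mu>. S = (\<Inter>k\<in>{2..CARD('n) - 1}. {f. R_mat k f - \<mu> k *\<^sub>R f = 0}))}"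

text \<open>
  Internal direct sum: every element of \<open>U\<close> is in exactly one way a sum of elements of the
  \<open>E i\<close>, and all these sums lie in \<open>U\<close>.
\<close>
definition is_direct_sum :: "'i set \<Rightarrow> ('i \<Rightarrow> 'v::real_vector set) \<Rightarrow> 'v set \<Rightarrow> bool" where
  "is_direct_sum I E U \<longleftrightarrow>
     finite I \<and> (\<forall>i\<in>I. subspace (E i)) \<and> bij_betw (\<lambda>x. \<Sum>i\<in>I. x i) (PiE I E) U"

end

theory Submission
  imports Defs
begin

text \<open>
  Each \<open>R\<^sub>k\<close> is a positive multiple of \<open>\<Sum>\<^sub>\<pi> 1\<^sub>\<pi> 1\<^sub>\<pi>\<^sup>T\<close>, so it is symmetric, it maps into \<open>V\<^sup>k\<close>, and its kernel is the
  orthogonal complement of \<open>V\<^sup>k\<close> (\<open>ker_R_mat\<close>).  Since the \<open>V\<^sup>k\<close> increase up to the whole space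
  (\<open>V_space_Suc\<close>, \<open>V_space_CARD\<close>), that complement splits orthogonally into \<open>W\<^sup>k\<^sup>+\<^sup>1, ..., W\<^sup>n\<close>, which is
  the formula for the kernel (\<open>ker_R_mat_direct_sum\<close>).

  Everything else rests on the fact that the \<open>R\<^sub>k\<close> commute (\<open>R_mat_commute\<close>).  Given this, \<open>R\<^sub>k\<close>
  preserves \<open>ker R\<^sub>j\<close>, hence, being symmetric, also its orthogonal complement \<open>V\<^sup>j\<close>, and so every \<open>W\<^sup>j\<close>.
  For commutation, let the group algebra act on positions and write the shuffle of \<open>m\<close> cards that
  reinserts \<open>k\<close> of them as \<open>S\<^sub>m\<^sub>,\<^sub>k = B\<^sub>m S\<^sub>m\<^sub>-\<^sub>1\<^sub>,\<^sub>k\<^sub>-\<^sub>1 T\<^sub>m\<close>, where \<open>B\<^sub>m\<close> (\<open>pull\<close>) takes one card out and lays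
  it aside and the adjoint \<open>T\<^sub>m\<close> (\<open>push\<close>) puts it back anywhere.  Coxeter relations alone give
  \<open>T\<^sub>m B\<^sub>m = m + J\<^sub>m + B\<^sub>m\<^sub>-\<^sub>1 s T\<^sub>m\<^sub>-\<^sub>1\<close> with the Jucys-Murphy element \<open>J\<^sub>m\<close>, and from this, by induction,
  \<open>T\<^sub>m S\<^sub>m\<^sub>,\<^sub>k = X\<^sub>k T\<^sub>m\<close> where \<open>X\<^sub>k = S\<^sub>m\<^sub>-\<^sub>1\<^sub>,\<^sub>k + k (m + 1 - k + J\<^sub>m) S\<^sub>m\<^sub>-\<^sub>1\<^sub>,\<^sub>k\<^sub>-\<^sub>1\<close> (\<open>push_mult_shuffle\<close>).  As \<open>J\<^sub>m\<close>
  commutes with all permutations of the other \<open>m - 1\<close> positions, the \<open>X\<^sub>k\<close> commute with the shuffles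
  of \<open>m - 1\<close> cards if these commute with each other, and the identity together with its adjoint
  carries commutation from \<open>m - 1\<close> to \<open>m\<close> cards (\<open>shuffle_commute\<close>).

  The spectral theorem splits \<open>V\<^sup>0\<close> and each \<open>W\<^sup>j\<close> into common eigenvectors, but the theorem asks for the
  simultaneous eigenspaces of the whole space.  So an eigenspace that meets one of these subspaces in
  a nonzero vector must lie inside it, that is, the eigenvalues must determine the subspace.  For \<open>j \<ge> 3\<close>
  this is the kernel formula: on \<open>W\<^sup>j\<close> the matrix \<open>R\<^sub>j\<^sub>-\<^sub>1\<close> vanishes and \<open>R\<^sub>j\<close> (if \<open>j < n\<close>) is injective.  No
  kernel separates \<open>V\<^sup>0\<close> from \<open>W\<^sup>2\<close>; here the eigenvalue of the constants under \<open>R\<^sub>2\<close> decides, since by a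
  maximum principle only constants have it (\<open>R_mat_2_constant\<close>).
\<close>

section \<open>Commuting shuffles from Coxeter relations\<close>

text \<open>
  The generators \<open>s i\<close> stand for the adjacent transpositions of positions, counted from the right:
  \<open>s i\<close> exchanges the two leftmost of the last \<open>i + 2\<close> letters.  Only the last \<open>m\<close> letters of a word are
  moved by the elements of level \<open>m\<close> below; the letters before them have been laid aside.  The
  anti-automorphism \<open>adj\<close> is the adjoint, that is, inversion of permutations.
\<close>
locale coxeter_ring =
  fixes s :: "nat \<Rightarrow> 'a::ring_1" and N :: nat and adj :: "'a \<Rightarrow> 'a"
  assumes s_sq: "i < N \<Longrightarrow> s i * s i = 1"
    and s_braid: "Suc i < N \<Longrightarrow> s i * s (Suc i) * s i = s (Suc i) * s i * s (Suc i)"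
    and s_far: "\<lbrakk>Suc i < j; j < N\<rbrakk> \<Longrightarrow> s i * s j = s j * s i"
    and adj_add: "adj (x + y) = adj x + adj y"
    and adj_mult: "adj (x * y) = adj y * adj x"
    and adj_one: "adj 1 = 1"
    and adj_s: "i < N \<Longrightarrow> adj (s i) = s i"
begin

text \<open>
  Operators act on functions of words.  The value of \<open>pull m f\<close> at a word is the sum of \<open>f\<close> over the \<open>m\<close>
  words obtained by moving one of the last \<open>m\<close> letters to their front; \<open>push m\<close> is the adjoint, which
  moves the first of these letters to any of the \<open>m\<close> places.  The formulas say that the letter to be
  pulled is already at the front, or is first pulled to the front of the last \<open>m - 1\<close> letters.
\<close>
fun pull :: "nat \<Rightarrow> 'a" where
  "pull 0 = 0"
| "pull (Suc 0) = 1"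
| "pull (Suc (Suc m)) = 1 + pull (Suc m) * s m"

fun push :: "nat \<Rightarrow> 'a" where
  "push 0 = 0"
| "push (Suc 0) = 1"
| "push (Suc (Suc m)) = 1 + s m * push (Suc m)"

text \<open>
  The Jucys-Murphy element: the sum of the transpositions that exchange the first of the last \<open>m\<close>
  letters with one of the others.
\<close>
fun murphy :: "nat \<Rightarrow> 'a" where
  "murphy 0 = 0"
| "murphy (Suc 0) = 0"
| "murphy (Suc (Suc m)) = s m + s m * murphy (Suc m) * s m"

text \<open>
  Take \<open>k\<close> of the last \<open>m\<close> letters out, one after the other, and reinsert them in the reverse order.
\<close>
fun shuffle :: "nat \<Rightarrow> nat \<Rightarrow> 'a" where
  "shuffle m 0 = 1"
| "shuffle 0 (Suc k) = 0"
| "shuffle (Suc m) (Suc k) = pull (Suc m) * shuffle m k * push (Suc m)"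

lemma s_sq_left: "i < N \<Longrightarrow> s i * (s i * x) = x"
  by (simp add: s_sq mult.assoc[symmetric])

lemma s_commute_pull: "m \<le> j \<Longrightarrow> j < N \<Longrightarrow> s j * pull m = pull m * s j"
proof (induction m rule: pull.induct)
  case (3 m)
  then have "s j * pull (Suc m) = pull (Suc m) * s j" "s j * s m = s m * s j"
    using s_far[of m j] by auto
  then show ?case
    by (simp add: algebra_simps) (metis mult.assoc)
qed auto

lemma s_commute_push: "m \<le> j \<Longrightarrow> j < N \<Longrightarrow> s j * push m = push m * s j"
proof (induction m rule: push.induct)
  case (3 m)
  then have "s j * push (Suc m) = push (Suc m) * s j" "s j * s m = s m * s j"
    using s_far[of m j] by auto
  then show ?case
    by (simp add: algebra_simps) (metis mult.assoc)
qed auto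

lemma s_commute_shuffle: "m \<le> j \<Longrightarrow> j < N \<Longrightarrow> s j * shuffle m k = shuffle m k * s j"
proof (induction m k rule: shuffle.induct)
  case (3 m k)
  then have "s j * shuffle m k = shuffle m k * s j"
    by simp
  moreover have "s j * pull (Suc m) = pull (Suc m) * s j" "s j * push (Suc m) = push (Suc m) * s j"
    using 3 s_commute_pull s_commute_push by auto
  ultimately show ?case
    by simp (metis mult.assoc)
qed auto

lemma s_commute_murphy: "m \<le> j \<Longrightarrow> j < N \<Longrightarrow> s j * murphy m = murphy m * s j"
proof (induction m rule: murphy.induct)
  case (3 m)
  then have "s j * murphy (Suc m) = murphy (Suc m) * s j" "s j * s m = s m * s j"
    using s_far[of m j] by auto
  then show ?case
    by (simp add: algebra_simps) (metis mult.assoc)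
qed auto

lemma commute_left: "x * y = y * x \<Longrightarrow> x * (y * z) = y * (x * (z::'a))"
  by (metis mult.assoc)

lemma triple_left: "x * y * z = x' * y' * z' \<Longrightarrow> x * (y * (z * w)) = x' * (y' * (z' * (w::'a)))"
  by (metis mult.assoc)

text \<open>
  \<open>s j\<close> exchanges two letters behind the first one and so permutes the summands of the Jucys-Murphy
  element.
\<close>
lemma murphy_commute_s: "Suc j < m \<Longrightarrow> m \<le> N \<Longrightarrow> murphy (Suc m) * s j = s j * murphy (Suc m)"
proof (induction m arbitrary: j)
  case (Suc m)
  then have m: "m < N" by simp
  show ?case
  proof (cases "Suc j < m")
    case True
    then have "murphy (Suc m) * s j = s j * murphy (Suc m)" "s m * s j = s j * s m"
      using Suc s_far[of j m] by auto
    then show ?thesis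
      by (simp add: algebra_simps) (metis mult.assoc)
  next
    case False
    with Suc.prems have i: "m = Suc j" by simp
    define a b K where "a = s j" and "b = s (Suc j)" and "K = murphy (Suc j)"
    have murphy: "murphy (Suc (Suc m)) = b + b * a * b + b * a * K * a * b"
      by (simp add: i a_def b_def K_def algebra_simps)
    have a: "a * a = 1" and b: "b * b = 1" and ab: "b * a * b = a * b * a" and bK: "b * K = K * b"
      using s_sq m i s_braid[of j] s_commute_murphy[of "Suc j" "Suc j"] by (auto simp: a_def b_def K_def)
    have "b * a * K * a * b * a = b * a * K * (b * a * b)"
      using ab by (simp add: mult.assoc)
    also have "\<dots> = b * a * b * K * a * b"
      by (simp add: mult.assoc bK[THEN commute_left])
    also have "\<dots> = a * (b * a * K * a * b)"
      by (simp add: ab mult.assoc ab[THEN triple_left])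
    finally have K: "b * a * K * a * b * a = a * (b * a * K * a * b)" .
    have "(b + b * a * b) * a = a * (b + b * a * b)"
      using a ab by (simp add: algebra_simps) (metis mult.assoc mult_1 mult_1_right)
    with K have "murphy (Suc (Suc m)) * a = a * murphy (Suc (Suc m))"
      unfolding murphy by (simp add: algebra_simps)
    then show ?thesis by (simp add: a_def)
  qed
qed simp

lemma murphy_commute_pull: "j \<le> m \<Longrightarrow> m \<le> N \<Longrightarrow> murphy (Suc m) * pull j = pull j * murphy (Suc m)"
proof (induction j rule: pull.induct)
  case (3 j)
  then have "murphy (Suc m) * pull (Suc j) = pull (Suc j) * murphy (Suc m)" "murphy (Suc m) * s j = s j * murphy (Suc m)"
    using murphy_commute_s[of j m] by auto
  then show ?case
    by (simp add: algebra_simps) (metis mult.assoc)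
qed auto

lemma murphy_commute_push: "j \<le> m \<Longrightarrow> m \<le> N \<Longrightarrow> murphy (Suc m) * push j = push j * murphy (Suc m)"
proof (induction j rule: push.induct)
  case (3 j)
  then have "murphy (Suc m) * push (Suc j) = push (Suc j) * murphy (Suc m)" "murphy (Suc m) * s j = s j * murphy (Suc m)"
    using murphy_commute_s[of j m] by auto
  then show ?case
    by (simp add: algebra_simps) (metis mult.assoc)
qed auto

lemma murphy_commute_shuffle: "j \<le> m \<Longrightarrow> m \<le> N \<Longrightarrow> murphy (Suc m) * shuffle j k = shuffle j k * murphy (Suc m)"
proof (induction j k rule: shuffle.induct)
  case (3 j k)
  then have "murphy (Suc m) * shuffle j k = shuffle j k * murphy (Suc m)"
    "murphy (Suc m) * pull (Suc j) = pull (Suc j) * murphy (Suc m)" "murphy (Suc m) * push (Suc j) = push (Suc j) * murphy (Suc m)"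
    using murphy_commute_pull murphy_commute_push by auto
  then show ?case
    by simp (metis mult.assoc)
qed auto

text \<open>
  Inserting a letter \<open>b\<close> and pulling a letter out either returns \<open>b\<close> itself (\<open>m + 2\<close> ways) or exchanges \<open>b\<close>
  for some other letter \<open>c\<close>.  In the second case one may as well pull \<open>c\<close> first and insert \<open>b\<close> then,
  except that the places left and right of \<open>c\<close> have become one; the Jucys-Murphy element makes up for
  this.
\<close>
lemma push_mult_pull:
  "m < N \<Longrightarrow> push (Suc (Suc m)) * pull (Suc (Suc m)) =
     of_nat (Suc (Suc m)) + murphy (Suc (Suc m)) + pull (Suc m) * s m * push (Suc m)"
proof (induction m)
  case 0
  then show ?case by (simp add: algebra_simps s_sq)
next
  case (Suc m)
  define a b t u K where "a = s m" and "b = s (Suc m)" and "t = push (Suc m)" and "u = pull (Suc m)"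
    and "K = murphy (Suc (Suc m))"
  have a: "a * a = 1" and b: "b * b = 1" and ab: "b * a * b = a * b * a"
    and bt: "b * t = t * b" and bu: "b * u = u * b"
    using s_sq Suc.prems s_braid[of m] s_commute_push[of "Suc m" "Suc m"] s_commute_pull[of "Suc m" "Suc m"]
    by (auto simp: a_def b_def t_def u_def)
  have IH: "(1 + a * t) * (1 + u * a) = of_nat (Suc (Suc m)) + K + u * a * t"
    using Suc by (simp add: a_def t_def u_def K_def)
  have "b * (u * a * t) * b = u * (b * a * b) * t"
    using bt bu by (metis mult.assoc)
  then have conj: "b * (u * a * t) * b = u * a * b * a * t"
    by (simp add: mult.assoc ab[THEN triple_left])
  have "(1 + b * (1 + a * t)) * (1 + (1 + u * a) * b)
      = 1 + b * (1 + a * t) + (1 + u * a) * b + b * ((1 + a * t) * (1 + u * a)) * b"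
    by (simp add: algebra_simps)
  also have "b * ((1 + a * t) * (1 + u * a)) * b
      = of_nat (Suc (Suc m)) * (b * b) + b * K * b + u * a * b * a * t"
    unfolding IH conj[symmetric] by (simp add: algebra_simps of_nat_mult mult_of_nat_commute)
  finally have "(1 + b * (1 + a * t)) * (1 + (1 + u * a) * b) =
     of_nat (Suc (Suc (Suc m))) + (b + b * K * b) + (1 + u * a) * b * (1 + a * t)"
    by (simp add: algebra_simps b)
  then show ?case by (simp add: a_def b_def t_def u_def K_def)
qed

text \<open>
  Of two letters inserted in turn, it does not matter which is inserted first.
\<close>
lemma s_mult_push_mult_push: "m < N \<Longrightarrow> s m * push (Suc m) * push (Suc (Suc m)) = push (Suc m) * push (Suc (Suc m))"
proof (induction m)
  case 0
  then show ?case by (simp add: algebra_simps s_sq)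
next
  case (Suc m)
  define a b t where "a = s m" and "b = s (Suc m)" and "t = push (Suc m)"
  define t' where "t' = 1 + a * t"
  have a: "a * a = 1" and b: "b * b = 1" and ab: "b * a * b = a * b * a" and bt: "b * t = t * b"
    using s_sq Suc.prems s_braid[of m] s_commute_push[of "Suc m" "Suc m"]
    by (auto simp: a_def b_def t_def)
  have IH: "a * t * t' = t * t'"
    using Suc by (simp add: a_def t_def t'_def)
  have tt: "t' * b * t' = b * t' + a * b * t * t'"
    unfolding t'_def using bt by (simp add: algebra_simps)
  have "b * a * b * t * t' = a * b * (a * t * t')"
    by (simp add: ab[THEN triple_left] mult.assoc)
  then have "b * (t' * b * t') = t' + a * b * t * t'"
    unfolding tt IH by (simp add: distrib_left mult.assoc b s_sq_left[of "Suc m"] Suc.prems b_def)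
  then have "b * t' * (1 + b * t') = t' * (1 + b * t')"
    using tt by (simp add: algebra_simps)
  then show ?case by (simp add: a_def b_def t_def t'_def)
qed

text \<open>push_factor\<close>
text \<open>
  Shuffling \<open>m + 1\<close> letters after the first of them has been pushed in amounts to applying this element
  before the push.
\<close>
definition push_factor :: "nat \<Rightarrow> nat \<Rightarrow> 'a" where
  "push_factor m k = shuffle m (Suc k) + of_nat (Suc k) * ((of_nat (Suc m) - of_nat k) + murphy (Suc m)) * shuffle m k"

text \<open>
  Unfolding the shuffle as \<open>pull * shuffle * push\<close> and applying \<open>push_mult_pull\<close> leaves a term in which
  a shorter \<open>push\<close> meets a shorter shuffle, to which the induction hypothesis applies.  The generator
  \<open>s m\<close> turns the Jucys-Murphy element of level \<open>m + 1\<close> into that of level \<open>m + 2\<close>, at the price of \<open>-1\<close> in the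
  scalar, and is then absorbed by \<open>s_mult_push_mult_push\<close>.
\<close>
lemma push_mult_shuffle: "m \<le> N \<Longrightarrow> push (Suc m) * shuffle (Suc m) (Suc k) = push_factor m k * push (Suc m)"
proof (induction m arbitrary: k)
  case 0
  then show ?case by (cases k) (auto simp: push_factor_def)
next
  case (Suc m)
  then have m: "m < N" by simp
  define a t t' u j K where "a = s m" and "t = push (Suc m)" and "t' = push (Suc (Suc m))"
    and "u = pull (Suc m)" and "j = murphy (Suc m)" and "K = murphy (Suc (Suc m))"
  have tB: "t' * pull (Suc (Suc m)) = of_nat (Suc (Suc m)) + K + u * a * t"
    using push_mult_pull[OF m] by (simp add: a_def t_def t'_def u_def K_def)
  have at: "a * t * t' = t * t'"
    using s_mult_push_mult_push[OF m] by (simp add: a_def t_def t'_def)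
  have "a * K = 1 + j * a"
    by (simp add: K_def a_def j_def distrib_left s_sq_left[OF m] s_sq m mult.assoc)
  have aj: "a * j = K * a - 1"
    by (simp add: K_def a_def j_def distrib_right s_sq[OF m] mult.assoc)
  have aR: "a * shuffle m i = shuffle m i * a" for i
    unfolding a_def by (rule s_commute_shuffle) (use m in auto)
  have Ku: "K * u = u * K"
    unfolding K_def u_def by (rule murphy_commute_pull) (use Suc in auto)
  \<comment> \<open>The contribution of the exchanged letters: it has the form of the claim, with \<open>k\<close> for \<open>k + 1\<close>.\<close>
  have main: "u * a * t * shuffle (Suc m) k * t' = shuffle (Suc m) (Suc k) * t'
     + of_nat k * ((of_nat (Suc m) - of_nat k) + K) * shuffle (Suc m) k * t'"
  proof (cases k)
    case 0
    then show ?thesis using at by (simp add: u_def t_def mult.assoc)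
  next
    case k: (Suc i)
    define c :: 'a where "c = of_nat (Suc m) - of_nat i"
    define d :: 'a where "d = of_nat (Suc i)"
    have cc: "x * c = c * x" for x
      by (simp add: c_def algebra_simps mult_of_nat_commute)
    have dd: "x * d = d * x" for x
      by (simp add: d_def algebra_simps mult_of_nat_commute)
    have cl: "x * (c * y) = c * (x * y)" and dl: "x * (d * y) = d * (x * y)" for x y
      using cc dd by (metis mult.assoc)+
    have "t * shuffle (Suc m) k = (shuffle m k + d * (c + j) * shuffle m i) * t"
      using Suc.IH[of i] m k by (simp add: push_factor_def t_def c_def d_def j_def)
    then have "a * t * shuffle (Suc m) k * t' = a * ((shuffle m k + d * (c + j) * shuffle m i) * t * t')"
      by (simp add: mult.assoc)
    also have "\<dots> = (a * (shuffle m k + d * (c + j) * shuffle m i)) * t * t'"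
      by (simp add: mult.assoc)
    also have "a * (shuffle m k + d * (c + j) * shuffle m i) = a * shuffle m k + d * (c * a + a * j) * shuffle m i"
      by (simp add: distrib_left distrib_right mult.assoc dl[of a] cl[of a])
    also have "\<dots> = shuffle m k * a + d * (c + K) * shuffle m i * a - d * shuffle m i"
      unfolding aj by (simp add: distrib_left distrib_right left_diff_distrib right_diff_distrib mult.assoc aR)
    also have "(shuffle m k * a + d * (c + K) * shuffle m i * a - d * shuffle m i) * t * t'
       = shuffle m k * (a * t * t') + d * (c + K) * shuffle m i * (a * t * t') - d * shuffle m i * (t * t')"
      by (simp add: left_diff_distrib distrib_right mult.assoc)
    also have "\<dots> = (shuffle m k + d * (c - 1 + K) * shuffle m i) * t * t'"
      unfolding at by (simp add: algebra_simps)
    finally have "u * a * t * shuffle (Suc m) k * t' = u * (shuffle m k + d * (c - 1 + K) * shuffle m i) * t * t'"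
      by (simp add: mult.assoc)
    also have "\<dots> = (u * shuffle m k * t + d * (c - 1 + K) * (u * shuffle m i * t)) * t'"
      by (simp add: distrib_left distrib_right left_diff_distrib right_diff_distrib mult.assoc
            cl[of u] dl[of u] Ku[THEN commute_left, symmetric])
    also have "c - 1 = of_nat (Suc m) - of_nat k"
      by (simp add: c_def k)
    finally show ?thesis
      by (simp add: d_def k u_def t_def mult.assoc distrib_right distrib_left)
  qed
  have "t' * shuffle (Suc (Suc m)) (Suc k) = t' * pull (Suc (Suc m)) * shuffle (Suc m) k * t'"
    by (simp add: t'_def mult.assoc)
  also have "\<dots> = (of_nat (Suc (Suc m)) + K) * shuffle (Suc m) k * t' + u * a * t * shuffle (Suc m) k * t'"
    unfolding tB by (simp add: algebra_simps)
  also have "\<dots> = (shuffle (Suc m) (Suc k)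
      + of_nat (Suc k) * ((of_nat (Suc (Suc m)) - of_nat k) + K) * shuffle (Suc m) k) * t'"
    unfolding main by (simp add: algebra_simps)
  finally show ?case by (simp add: push_factor_def t'_def K_def)
qed

lemma adj_of_nat: "adj (of_nat k) = of_nat k"
proof (induction k)
  case 0
  show ?case using adj_add[of 0 0] by simp
qed (simp add: adj_add adj_one)

lemma adj_pull: "m \<le> Suc N \<Longrightarrow> adj (pull m) = push m"
  using adj_of_nat[of 0]
  by (induction m rule: pull.induct) (auto simp: adj_add adj_mult adj_one adj_s)

lemma adj_push: "m \<le> Suc N \<Longrightarrow> adj (push m) = pull m"
  using adj_of_nat[of 0]
  by (induction m rule: pull.induct) (auto simp: adj_add adj_mult adj_one adj_s)

lemma adj_murphy: "m \<le> Suc N \<Longrightarrow> adj (murphy m) = murphy m"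
  using adj_of_nat[of 0]
  by (induction m rule: murphy.induct) (auto simp: adj_add adj_mult adj_one adj_s mult.assoc)

lemma adj_shuffle: "m \<le> Suc N \<Longrightarrow> adj (shuffle m k) = shuffle m k"
  using adj_of_nat[of 0]
  by (induction m k rule: shuffle.induct) (auto simp: adj_mult adj_one adj_pull adj_push mult.assoc)

lemma adj_diff: "adj (x - y) = adj x - adj y"
  using adj_add[of "x - y" y] by (simp add: algebra_simps)

text \<open>
  The adjoint of \<open>push_mult_shuffle\<close>; the factor is self-adjoint because \<open>murphy\<close> commutes with the
  shuffles of one letter less.
\<close>
lemma shuffle_mult_pull:
  assumes "m \<le> N" shows "shuffle (Suc m) (Suc k) * pull (Suc m) = pull (Suc m) * push_factor m k"
proof -
  define c :: 'a where "c = of_nat (Suc m) - of_nat k"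
  define d :: 'a where "d = of_nat (Suc k)"
  have c: "adj c = c" "x * c = c * x" and d: "adj d = d" "x * d = d * x" for x
    unfolding c_def d_def adj_diff adj_of_nat by (simp_all add: algebra_simps mult_of_nat_commute)
  have murphy: "shuffle m k * murphy (Suc m) = murphy (Suc m) * shuffle m k"
    using murphy_commute_shuffle[of m m k] assms by simp
  have "adj (push_factor m k) = shuffle m (Suc k) + shuffle m k * ((c + murphy (Suc m)) * d)"
    using assms unfolding push_factor_def c_def[symmetric] d_def[symmetric]
    by (simp add: adj_add adj_mult adj_shuffle adj_murphy c(1) d(1))
  also have "\<dots> = shuffle m (Suc k) + d * (shuffle m k * (c + murphy (Suc m)))"
    using d(2) by (metis mult.assoc)
  also have "shuffle m k * (c + murphy (Suc m)) = (c + murphy (Suc m)) * shuffle m k"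
    using murphy c(2) by (simp add: distrib_left distrib_right)
  finally have "adj (push_factor m k) = push_factor m k"
    by (simp add: push_factor_def c_def d_def mult.assoc)
  then have "adj (push (Suc m) * shuffle (Suc m) (Suc k)) = adj (push_factor m k * push (Suc m))"
    using push_mult_shuffle[OF assms, of k] by simp
  then show ?thesis
    using \<open>adj (push_factor m k) = push_factor m k\<close> assms unfolding adj_mult by (simp add: adj_shuffle adj_push del: shuffle.simps)
qed

text \<open>
  The factor of \<open>push_mult_shuffle\<close> is built from the shuffles of one letter less and an element that
  commutes with them.  Hence it can be moved across the inner shuffle, from the \<open>push\<close> side of a product
  to the \<open>pull\<close> side.
\<close>
theorem shuffle_commute: "m \<le> Suc N \<Longrightarrow> shuffle m i * shuffle m k = shuffle m k * shuffle m i"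
proof (induction m arbitrary: i k)
  case 0
  then show ?case by (cases i; cases k) auto
next
  case (Suc m)
  then have m: "m \<le> N" by simp
  have RX: "shuffle m i * push_factor m k = push_factor m k * shuffle m i" for i k
  proof -
    define c :: 'a where "c = of_nat (Suc m) - of_nat k"
    define d :: 'a where "d = of_nat (Suc k)"
    have c: "shuffle m i * c = c * shuffle m i" and d: "shuffle m i * d = d * shuffle m i"
      by (simp_all add: c_def d_def algebra_simps mult_of_nat_commute)
    have murphy: "shuffle m i * murphy (Suc m) = murphy (Suc m) * shuffle m i"
      using murphy_commute_shuffle[of m m i] m by simp
    have shuffle: "shuffle m i * shuffle m l = shuffle m l * shuffle m i" for l
      using Suc by simp
    show ?thesis
      unfolding push_factor_def c_def[symmetric] d_def[symmetric]
      by (simp add: distrib_left distrib_right mult.assoc shuffle[of k] shuffle[of "Suc k"] c[THEN commute_left]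
          d[THEN commute_left] murphy[THEN commute_left])
  qed
  show ?case
  proof (cases "i = 0 \<or> k = 0")
    case False
    then obtain i' k' where ik: "i = Suc i'" "k = Suc k'" by (metis nat.exhaust)
    have "shuffle (Suc m) i * shuffle (Suc m) k = pull (Suc m) * shuffle m i' * (push (Suc m) * shuffle (Suc m) (Suc k'))"
      by (simp add: ik mult.assoc)
    also have "\<dots> = pull (Suc m) * push_factor m k' * shuffle m i' * push (Suc m)"
      unfolding push_mult_shuffle[OF m] by (simp add: mult.assoc RX[THEN commute_left])
    also have "\<dots> = shuffle (Suc m) k * shuffle (Suc m) i"
      unfolding shuffle_mult_pull[OF m, symmetric] by (simp add: ik mult.assoc)
    finally show ?thesis .
  qed auto
qed

end

section \<open>Position swaps as operators\<close>

text \<open>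
  The endomorphisms of a Euclidean space as a type, so that their composition is the multiplication of
  a ring.
\<close>
typedef (overloaded) 'v endo = "{f :: 'v::euclidean_space \<Rightarrow> 'v. linear f}"
  morphisms app Endo
  using linear_zero by blast

setup_lifting type_definition_endo

lemma linear_app: "linear (app x)"
  using app[of x] by simp

instantiation endo :: (euclidean_space) ring_1
begin

lift_definition zero_endo :: "'a endo" is "\<lambda>_. 0" by (rule linear_zero)
lift_definition one_endo :: "'a endo" is "\<lambda>v. v" by (rule linear_ident)
lift_definition plus_endo :: "'a endo \<Rightarrow> 'a endo \<Rightarrow> 'a endo" is "\<lambda>f g v. f v + g v"
  by (rule linear_compose_add)
lift_definition minus_endo :: "'a endo \<Rightarrow> 'a endo \<Rightarrow> 'a endo" is "\<lambda>f g v. f v - g v"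
  by (rule linear_compose_sub)
lift_definition uminus_endo :: "'a endo \<Rightarrow> 'a endo" is "\<lambda>f v. - f v"
  by (rule linear_compose_neg)
lift_definition times_endo :: "'a endo \<Rightarrow> 'a endo \<Rightarrow> 'a endo" is "\<lambda>f g v. f (g v)"
  using linear_compose by (auto simp: o_def)

instance
proof
  fix a b c :: "'a endo"
  have "\<exists>v::'a. v \<noteq> 0"
    using nonempty_Basis nonzero_Basis by blast
  then show "(0::'a endo) \<noteq> 1"
    by transfer (metis)
  show "a * (b + c) = a * b + a * c"
    by transfer (simp add: linear_add)
qed (transfer; simp add: algebra_simps)+

end

lift_definition adj :: "'v::euclidean_space endo \<Rightarrow> 'v endo" is adjoint
  by (rule adjoint_linear)

lemma adj_works: "app (adj x) v \<bullet> w = v \<bullet> app x w"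
  by transfer (simp add: adjoint_works inner_commute)

lemma adj_eqI:
  assumes "\<And>v w. app y v \<bullet> w = v \<bullet> app x w"
  shows "adj x = y"
proof -
  have "app (adj x) v = app y v" for v
    by (rule vector_eq_rdot[THEN iffD1]) (simp add: adj_works assms)
  then show ?thesis
    by (simp add: app_inject[symmetric] fun_eq_iff)
qed

lemma endo_eqI: "(\<And>v. app x v = app y v) \<Longrightarrow> x = y"
  by (simp add: app_inject[symmetric] fun_eq_iff)

lemmas app_simps [simp] = zero_endo.rep_eq one_endo.rep_eq plus_endo.rep_eq minus_endo.rep_eq
  uminus_endo.rep_eq times_endo.rep_eq

abbreviation positions :: "'n::{finite,linorder} list" where
  "positions \<equiv> sorted_list_of_set UNIV"

definition full_word :: "'n::finite list \<Rightarrow> bool" where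
  "full_word w \<longleftrightarrow> distinct w \<and> length w = CARD('n)"

lemma full_word_set: "full_word (w :: 'n::finite list) \<Longrightarrow> set w = UNIV"
  unfolding full_word_def
  by (metis card_subset_eq distinct_card finite subset_UNIV)

lemma full_perm_word: "full_word (perm_word \<sigma>)"
  by (simp add: full_word_def perm_word_def distinct_map inj_on_def apply_inj)

lemma inj_perm_word: "inj perm_word"
proof
  fix \<sigma> \<tau> :: "'a perm"
  assume "perm_word \<sigma> = perm_word \<tau>"
  then have "apply (inverse \<sigma>) x = apply (inverse \<tau>) x" for x
    by (simp add: perm_word_def)
  then have "inverse \<sigma> = inverse \<tau>"
    by (simp add: perm_eq_iff)
  then show "\<sigma> = \<tau>"
    by (metis perm_eq_iff apply_inverse inv_inv_eq bij_apply)
qed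

lemma perm_word_surj:
  assumes "full_word (w :: 'n::{finite,linorder} list)"
  obtains \<sigma> where "perm_word \<sigma> = w"
proof -
  define g where "g x = the (map_of (zip positions w) x)" for x :: 'n
  have g: "map g positions = w"
  proof (rule nth_equalityI)
    fix i assume "i < length (map g positions)"
    then show "map g positions ! i = w ! i"
      using assms by (simp add: g_def full_word_def map_of_zip_nth)
  qed (use assms in \<open>simp add: full_word_def\<close>)
  then have "range g = UNIV"
    using full_word_set[OF assms] by (metis set_map finite set_sorted_list_of_set)
  then have "bij g"
    by (simp add: bij_def finite_UNIV_surj_inj)
  then have "apply (Perm g) = g"
    by (simp add: Perm_inverse)
  then have "perm_word (inverse (Perm g)) = w"
    by (simp add: perm_word_def g)
  then show ?thesis by (rule that)
qed

text \<open>
  The positions are counted from the right, so that the index of a swap is the number of letters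
  behind the two that are exchanged, as in \<open>perm_word_pos_swap\<close>.
\<close>
definition pos_swap :: "nat \<Rightarrow> 'n::{finite,linorder} perm" where
  "pos_swap i = \<langle>positions ! (CARD('n) - 2 - i) \<leftrightarrow> positions ! (CARD('n) - 1 - i)\<rangle>"

lemma pos_swap_eq:
  assumes "positions = p @ x # y # (u :: 'n::{finite,linorder} list)"
  shows "pos_swap (length u) = \<langle>x \<leftrightarrow> y\<rangle>"
proof -
  have "CARD('n) = length p + 2 + length u"
    using arg_cong[OF assms, of length] by simp
  then have "CARD('n) - 2 - length u = length p" "CARD('n) - 1 - length u = Suc (length p)"
    by auto
  then show ?thesis
    unfolding pos_swap_def assms by (simp add: nth_append)
qed

lemma perm_word_pos_swap:
  fixes \<sigma> :: "'n::{finite,linorder} perm"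
  assumes "perm_word \<sigma> = p @ a # b # u"
  shows "perm_word (pos_swap (length u) * \<sigma>) = p @ b # a # u"
proof -
  define f where "f = apply (inverse \<sigma>)"
  have f: "map f positions = p @ a # b # u"
    using assms by (simp add: perm_word_def f_def)
  then obtain P x y U where pos: "positions = P @ x # y # U" and P: "map f P = p" "f x = a" "f y = b"
    and U: "map f U = u"
    by (auto simp: map_eq_append_conv map_eq_Cons_conv)
  have "distinct (P @ x # y # U)"
    unfolding pos[symmetric] by simp
  then have "map (\<lambda>z. f (\<langle>x \<leftrightarrow> y\<rangle> \<langle>$\<rangle> z)) P = p" "map (\<lambda>z. f (\<langle>x \<leftrightarrow> y\<rangle> \<langle>$\<rangle> z)) U = u"
    unfolding P(1)[symmetric] U[symmetric]
    by (auto intro!: arg_cong[of _ _ f] apply_swap_same)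
  moreover have "apply (inverse (\<langle>x \<leftrightarrow> y\<rangle> * \<sigma>)) = (\<lambda>z. f (\<langle>x \<leftrightarrow> y\<rangle> \<langle>$\<rangle> z))"
    by (simp add: f_def apply_times o_def)
  ultimately have "perm_word (\<langle>x \<leftrightarrow> y\<rangle> * \<sigma>) = p @ b # a # u"
    unfolding perm_word_def pos using P by simp
  then show ?thesis
    using pos_swap_eq[OF pos] U by (metis length_map)
qed

lemma positions_split:
  assumes "Suc i < CARD('n)"
  obtains p x y u where "positions = p @ x # y # (u :: 'n::{finite,linorder} list)" "length u = i"
proof -
  define k where "k = CARD('n) - 2 - i"
  have k: "Suc k < length (positions :: 'n list)" "CARD('n) - Suc (Suc k) = i"
    using assms by (auto simp: k_def)
  then have "positions = take k positions @ positions ! k # positions ! Suc k # drop (Suc (Suc k)) (positions :: 'n list)"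
    by (metis Cons_nth_drop_Suc Suc_lessD append_take_drop_id)
  then show ?thesis
    by (rule that) (use k in simp)
qed

lemma pos_swap_sq: "pos_swap i * pos_swap i = (1 :: 'n::{finite,linorder} perm)"
  by (simp add: pos_swap_def)

lemma swap_braid: "a \<noteq> b \<Longrightarrow> b \<noteq> c \<Longrightarrow> a \<noteq> c \<Longrightarrow>
  \<langle>a \<leftrightarrow> b\<rangle> * \<langle>b \<leftrightarrow> c\<rangle> * \<langle>a \<leftrightarrow> b\<rangle> = \<langle>b \<leftrightarrow> c\<rangle> * \<langle>a \<leftrightarrow> b\<rangle> * \<langle>b \<leftrightarrow> c\<rangle>"
  by (rule perm_eqI) (auto simp: apply_times swap.rep_eq Transposition.transpose_def)

lemma swap_far: "distinct [a,b,c,d] \<Longrightarrow> \<langle>a \<leftrightarrow> b\<rangle> * \<langle>c \<leftrightarrow> d\<rangle> = \<langle>c \<leftrightarrow> d\<rangle> * \<langle>a \<leftrightarrow> b\<rangle>"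
  by (rule perm_eqI) (auto simp: apply_times swap.rep_eq Transposition.transpose_def)

lift_definition swap_op :: "nat \<Rightarrow> (real ^ ('n::{finite,linorder} perm)) endo" is
  "\<lambda>i f. \<chi> \<sigma>. f $ (pos_swap i * \<sigma>)"
  by (rule linearI) (auto simp: vec_eq_iff)

lemma pos_swap_braid:
  assumes "Suc (Suc i) < CARD('n)"
  shows "pos_swap i * pos_swap (Suc i) * pos_swap i = pos_swap (Suc i) * pos_swap i * (pos_swap (Suc i) :: 'n::{finite,linorder} perm)"
proof -
  obtain p x y z u where pos: "positions = p @ x # y # (z # u :: 'n list)" and u: "length u = i"
    using positions_split[OF assms] by (metis length_Suc_conv)
  have "pos_swap (Suc i) = \<langle>x \<leftrightarrow> y\<rangle>" "pos_swap i = \<langle>y \<leftrightarrow> z\<rangle>"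
    using pos_swap_eq[OF pos] pos_swap_eq[of "p @ [x]" y z u] pos u by simp_all
  moreover have "distinct (p @ x # y # z # u)"
    unfolding pos[symmetric] by simp
  ultimately show ?thesis
    using swap_braid[of z y x] by (auto simp: swap_sym)
qed

lemma pos_swap_far:
  assumes "Suc i < j" "Suc j < CARD('n)"
  shows "pos_swap i * pos_swap j = pos_swap j * (pos_swap i :: 'n::{finite,linorder} perm)"
proof -
  obtain p x y u where pos: "positions = p @ x # y # (u :: 'n list)" and u: "length u = j"
    using positions_split[OF assms(2)] .
  define k where "k = j - 2 - i"
  have k: "Suc k < length u" "length (drop (Suc (Suc k)) u) = i"
    using assms u by (auto simp: k_def)
  then have "u = take k u @ u ! k # u ! Suc k # drop (Suc (Suc k)) u"
    by (metis Cons_nth_drop_Suc Suc_lessD append_take_drop_id)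
  then obtain q a b v where v: "u = q @ a # b # v" "length v = i"
    using k(2) by blast
  have "pos_swap j = \<langle>x \<leftrightarrow> y\<rangle>" "pos_swap i = \<langle>a \<leftrightarrow> b\<rangle>"
    using pos_swap_eq[OF pos] pos_swap_eq[of "p @ x # y # q" a b v] pos u v by simp_all
  moreover have "distinct (p @ x # y # q @ a # b # v)"
    unfolding v(1)[symmetric] pos[symmetric] by simp
  ultimately show ?thesis
    using swap_far[of a b x y] by auto
qed

lemma swap_op_mult: "app (swap_op i * swap_op j) f $ \<sigma> = f $ (pos_swap j * pos_swap i * \<sigma>)"
  by (simp add: swap_op.rep_eq mult.assoc)

lemma adj_swap_op: "adj (swap_op i) = (swap_op i :: (real ^ ('n::{finite,linorder} perm)) endo)"
proof (rule adj_eqI)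
  fix v w :: "real ^ ('n perm)"
  have "bij (\<lambda>\<sigma>. pos_swap i * \<sigma> :: 'n perm)"
    by (rule involuntory_imp_bij) (simp add: mult.assoc[symmetric] pos_swap_sq)
  have "app (swap_op i) v \<bullet> w = (\<Sum>\<sigma>\<in>UNIV. v $ (pos_swap i * \<sigma>) * w $ (pos_swap i * (pos_swap i * \<sigma>)))"
    by (simp add: inner_vec_def swap_op.rep_eq mult.assoc[symmetric] pos_swap_sq)
  also have "\<dots> = (\<Sum>\<sigma>\<in>UNIV. v $ \<sigma> * w $ (pos_swap i * \<sigma>))"
    using sum.reindex_bij_betw[OF \<open>bij _\<close>, of "\<lambda>\<sigma>. v $ \<sigma> * w $ (pos_swap i * \<sigma>)"] by simp
  also have "\<dots> = v \<bullet> app (swap_op i) w"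
    by (simp add: inner_vec_def swap_op.rep_eq)
  finally show "app (swap_op i) v \<bullet> w = v \<bullet> app (swap_op i) w" .
qed

interpretation words: coxeter_ring "swap_op :: nat \<Rightarrow> (real ^ ('n::{finite,linorder} perm)) endo" "CARD('n) - 1" adj
proof
  fix i j :: nat and x y :: "(real ^ ('n perm)) endo"
  show "swap_op i * swap_op i = (1 :: (real ^ ('n perm)) endo)"
    by (rule endo_eqI) (simp add: vec_eq_iff swap_op_mult pos_swap_sq del: app_simps, simp)
  show "swap_op i * swap_op (Suc i) * swap_op i = swap_op (Suc i) * swap_op i * (swap_op (Suc i) :: (real ^ ('n perm)) endo)"
    if "Suc i < CARD('n) - 1"
    using that pos_swap_braid[of i, where 'n='n]
    by (intro endo_eqI) (auto simp: vec_eq_iff swap_op.rep_eq mult.assoc[symmetric])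
  show "swap_op i * swap_op j = swap_op j * (swap_op i :: (real ^ ('n perm)) endo)"
    if "Suc i < j" "j < CARD('n) - 1"
    using that pos_swap_far[of i j, where 'n='n]
    by (intro endo_eqI) (auto simp: vec_eq_iff swap_op.rep_eq mult.assoc[symmetric])
  show "adj (x + y) = adj x + adj y"
    by (rule adj_eqI) (simp add: adj_works inner_add_left inner_add_right)
  show "adj (x * y) = adj y * adj x"
    by (rule adj_eqI) (simp add: adj_works)
  show "adj 1 = (1 :: (real ^ ('n perm)) endo)"
    by (rule adj_eqI) simp
  show "adj (swap_op i) = (swap_op i :: (real ^ ('n perm)) endo)"
    by (rule adj_swap_op)
qed

section \<open>The shuffle operators on words\<close>

text \<open>
  A vector read as a function of words.  The words in question are those with \<open>full_word\<close>.
\<close>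
definition val :: "real ^ ('n::{finite,linorder} perm) \<Rightarrow> 'n list \<Rightarrow> real" where
  "val f w = f $ inv perm_word w"

lemma val_perm_word [simp]: "val f (perm_word \<sigma>) = f $ \<sigma>"
  by (simp add: val_def inv_f_f[OF inj_perm_word])

lemma val_add: "val (f + g) w = val f w + val g w"
  by (simp add: val_def)

lemma val_swap_op:
  assumes "full_word (p @ a # b # u)"
  shows "val (app (swap_op (length u)) f) (p @ a # b # u) = val f (p @ b # a # u)"
proof -
  obtain \<sigma> where "perm_word \<sigma> = p @ a # b # u"
    using perm_word_surj[OF assms] .
  then show ?thesis
    using perm_word_pos_swap[of \<sigma> p a b u] val_perm_word[of _ \<sigma>] val_perm_word[of f "pos_swap (length u) * \<sigma>"]
    by (simp add: swap_op.rep_eq)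
qed

lemma full_word_perm: "full_word w \<Longrightarrow> distinct w' \<Longrightarrow> set w' = set w \<Longrightarrow> full_word w'"
  unfolding full_word_def by (metis distinct_card)

lemma val_pull:
  fixes p u :: "'n::{finite,linorder} list"
  assumes "full_word (p @ u)"
  shows "val (app (words.pull (length u)) f) (p @ u) = (\<Sum>c\<in>set u. val f (p @ c # remove1 c u))"
  using assms
proof (induction u arbitrary: p f rule: length_induct)
  case (1 u)
  show ?case
  proof (cases u)
    case Nil
    then show ?thesis by (simp add: val_def)
  next
    case (Cons a v)
    show ?thesis
    proof (cases v)
      case Nil
      then show ?thesis by (simp add: Cons)
    next
      case v: (Cons b v')
      have full: "full_word ((p @ [a]) @ v)"
        using 1 Cons by simp
      then have d: "distinct (p @ a # v)" by (simp add: full_word_def)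
      have *: "val (app (swap_op (length v')) f) ((p @ [a]) @ c # remove1 c v) = val f (p @ c # remove1 c u)"
        if c: "c \<in> set v" for c
      proof -
        have "full_word (p @ a # c # remove1 c v)"
          by (rule full_word_perm[OF full]) (use c d in auto)
        moreover have "length (remove1 c v) = length v'"
          using c by (simp add: length_remove1) (simp add: v)
        moreover have "remove1 c u = a # remove1 c v"
          using c d Cons by auto
        ultimately show ?thesis
          using val_swap_op[of p a c "remove1 c v" f] by simp
      qed
      have "val (app (words.pull (length u)) f) (p @ u)
         = val f (p @ u) + val (app (words.pull (length v)) (app (swap_op (length v')) f)) ((p @ [a]) @ v)"
        by (simp add: Cons v val_add)
      also have "val (app (words.pull (length v)) (app (swap_op (length v')) f)) ((p @ [a]) @ v)
         = (\<Sum>c\<in>set v. val (app (swap_op (length v')) f) ((p @ [a]) @ c # remove1 c v))"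
        using 1(1)[rule_format, OF _ full] Cons by simp
      also have "\<dots> = (\<Sum>c\<in>set v. val f (p @ c # remove1 c u))"
        using * by simp
      finally show ?thesis
        using d by (simp add: Cons)
    qed
  qed
qed

definition insertions :: "'b \<Rightarrow> 'b list \<Rightarrow> 'b list set" where
  "insertions b u = {x. b \<in> set x \<and> remove1 b x = u}"

lemma insertions_Nil: "insertions b [] = {[b]}"
proof -
  have "remove1 b x = [] \<Longrightarrow> b \<in> set x \<Longrightarrow> x = [b]" for x
    by (cases x) (auto split: if_splits)
  then show ?thesis by (auto simp: insertions_def)
qed

lemma insertions_Cons:
  assumes "b \<noteq> a"
  shows "insertions b (a # u) = insert (b # a # u) ((#) a ` insertions b u)"
proof (intro set_eqI)
  fix x
  show "x \<in> insertions b (a # u) \<longleftrightarrow> x \<in> insert (b # a # u) ((#) a ` insertions b u)"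
    using assms by (cases x) (auto simp: insertions_def image_iff)
qed

lemma finite_insertions: "b \<notin> set u \<Longrightarrow> finite (insertions b u)"
  by (induction u) (auto simp: insertions_Nil insertions_Cons)

lemma val_push:
  fixes p u :: "'n::{finite,linorder} list"
  assumes "full_word (p @ b # u)"
  shows "val (app (words.push (Suc (length u))) f) (p @ b # u) = (\<Sum>x\<in>insertions b u. val f (p @ x))"
  using assms
proof (induction u arbitrary: p)
  case Nil
  then show ?case by (simp add: insertions_Nil)
next
  case (Cons a u)
  then have d: "distinct (p @ b # a # u)" by (simp add: full_word_def)
  have full: "full_word ((p @ [a]) @ b # u)"
    by (rule full_word_perm[OF Cons.prems]) (use d in auto)
  have "val (app (words.push (Suc (length (a # u)))) f) (p @ b # a # u)
     = val f (p @ b # a # u) + val (app (words.push (Suc (length u))) f) ((p @ [a]) @ b # u)"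
    using val_swap_op[OF Cons.prems] by (simp add: val_add)
  also have "\<dots> = val f (p @ b # a # u) + (\<Sum>x\<in>insertions b u. val f (p @ a # x))"
    using Cons.IH[OF full] by simp
  also have "\<dots> = (\<Sum>x\<in>insertions b (a # u). val f (p @ x))"
  proof -
    have "b # a # u \<notin> (#) a ` insertions b u" "finite (insertions b u)"
      using d by (auto intro: finite_insertions)
    then show ?thesis
      using d by (subst insertions_Cons) (auto simp: sum.reindex)
  qed
  finally show ?case .
qed

definition subwords :: "nat \<Rightarrow> 'b list \<Rightarrow> 'b list set" where
  "subwords k u = {\<pi>. subseq \<pi> u \<and> length \<pi> + k = length u}"

definition arrangements :: "'b list \<Rightarrow> 'b list \<Rightarrow> 'b list set" where
  "arrangements \<pi> u = {x. distinct x \<and> set x = set u \<and> subseq \<pi> x}"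

lemma finite_subwords: "finite (subwords k u)"
proof (rule finite_subset)
  show "subwords k u \<subseteq> set (subseqs u)"
    by (auto simp: subwords_def)
qed simp

lemma finite_arrangements: "finite (arrangements \<pi> u)"
  by (rule finite_subset[OF _ finite_subset_distinct[of "set u"]]) (auto simp: arrangements_def)

lemma subseq_set: "subseq xs ys \<Longrightarrow> set xs \<subseteq> set ys"
  by (auto simp: subseq_conv_nths dest: in_set_nthsD)

lemma subseq_distinct: "subseq xs ys \<Longrightarrow> distinct ys \<Longrightarrow> distinct xs"
  by (auto simp: subseq_conv_nths)

lemma subseq_remove1_iff:
  assumes "distinct x"
  shows "subseq \<pi> (remove1 c x) \<longleftrightarrow> subseq \<pi> x \<and> c \<notin> set \<pi>"
proof
  assume *: "subseq \<pi> (remove1 c x)"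
  have "subseq (remove1 c x) x"
    using assms by (simp add: distinct_remove1_removeAll removeAll_filter_not_eq)
  then have "subseq \<pi> x" using * subseq_order.trans by blast
  moreover have "set \<pi> \<subseteq> set (remove1 c x)"
    using * by (rule subseq_set)
  ultimately show "subseq \<pi> x \<and> c \<notin> set \<pi>"
    using assms by auto
next
  assume *: "subseq \<pi> x \<and> c \<notin> set \<pi>"
  then have "subseq (filter (\<lambda>y. y \<noteq> c) \<pi>) (filter (\<lambda>y. y \<noteq> c) x)"
    by (intro subseq_filter) simp
  moreover have "filter (\<lambda>y. y \<noteq> c) \<pi> = \<pi>"
    using * by (intro filter_True) auto
  ultimately show "subseq \<pi> (remove1 c x)"
    using assms by (simp add: distinct_remove1_removeAll removeAll_filter_not_eq eq_commute)
qed

text \<open>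
  The passage from the recursion for shuffles to subwords.  Removing \<open>k\<close> letters one after the other
  leaves a subword \<open>\<pi>\<close>, and each \<open>\<pi>\<close> is reached in \<open>k!\<close> orders; reinserting the letters in turn produces
  every arrangement that contains \<open>\<pi>\<close> exactly once for each order.
\<close>
lemma val_shuffle:
  fixes p u :: "'n::{finite,linorder} list"
  assumes "full_word (p @ u)"
  shows "val (app (words.shuffle (length u) k) f) (p @ u) =
    fact k * (\<Sum>\<pi>\<in>subwords k u. \<Sum>x\<in>arrangements \<pi> u. val f (p @ x))"
  using assms
proof (induction k arbitrary: p u f)
  case 0
  then have d: "distinct u" by (simp add: full_word_def)
  have "subwords 0 u = {u}"
    by (auto simp: subwords_def subseq_same_length)
  moreover have "arrangements u u = {u}"
    using d by (auto simp: arrangements_def) (metis distinct_card subseq_same_length)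
  ultimately show ?case by simp
next
  case (Suc k)
  show ?case
  proof (cases u)
    case Nil
    then show ?thesis by (simp add: subwords_def val_def)
  next
    case (Cons a v)
    have d: "distinct u" using Suc.prems by (simp add: full_word_def)
    define m where "m = length v"
    have m: "length u = Suc m" by (simp add: m_def Cons)
    have step: "val (app (words.shuffle m k) (app (words.push (Suc m)) f)) (p @ c # remove1 c u)
       = fact k * (\<Sum>\<pi>\<in>{\<pi> \<in> subwords (Suc k) u. c \<notin> set \<pi>}. \<Sum>x\<in>arrangements \<pi> u. val f (p @ x))"
      if c: "c \<in> set u" for c
    proof -
      define u' where "u' = remove1 c u"
      have u': "length u' = m" "distinct u'" "set u' = set u - {c}"
        using c d m by (auto simp: u'_def length_remove1)
      have full: "full_word ((p @ [c]) @ u')"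
        by (rule full_word_perm[OF Suc.prems]) (use c d Suc.prems in \<open>auto simp: u'_def full_word_def\<close>)
      have sub: "subwords k u' = {\<pi> \<in> subwords (Suc k) u. c \<notin> set \<pi>}"
        using u'(1) m subseq_remove1_iff[OF d] by (auto simp: subwords_def u'_def)
      have T: "val (app (words.push (Suc m)) f) ((p @ [c]) @ y) = (\<Sum>x\<in>insertions c y. val f (p @ x))"
        if "y \<in> arrangements \<pi> u'" for y \<pi>
      proof -
        have y: "distinct y" "set y = set u'" using that by (auto simp: arrangements_def)
        then have "length y = m" using u' by (metis distinct_card)
        moreover have "full_word (p @ c # y)"
          by (rule full_word_perm[OF full]) (use y full in \<open>auto simp: full_word_def\<close>)
        ultimately show ?thesis using val_push[of p c y f] by simp
      qed
      \<comment> \<open>A word containing \<open>\<pi>\<close> arises in one way by inserting \<open>c\<close>: from the word with \<open>c\<close> removed.\<close>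
      have arr: "(\<Sum>y\<in>arrangements \<pi> u'. \<Sum>x\<in>insertions c y. g x) = (\<Sum>x\<in>arrangements \<pi> u. g x)"
        if "\<pi> \<in> subwords k u'" for \<pi> and g :: "'n list \<Rightarrow> real"
      proof -
        have c': "c \<notin> set \<pi>" using that unfolding sub by simp
        have fin: "finite (insertions c y)" if "y \<in> arrangements \<pi> u'" for y
          using that u' by (intro finite_insertions) (auto simp: arrangements_def)
        have "arrangements \<pi> u = (\<Union>y\<in>arrangements \<pi> u'. insertions c y)"
        proof (intro set_eqI iffI)
          fix x assume "x \<in> arrangements \<pi> u"
          then have "remove1 c x \<in> arrangements \<pi> u'" "c \<in> set x"
            using c' u' c by (auto simp: arrangements_def subseq_remove1_iff)
          then show "x \<in> (\<Union>y\<in>arrangements \<pi> u'. insertions c y)"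
            by (auto simp: insertions_def)
        next
          fix x assume "x \<in> (\<Union>y\<in>arrangements \<pi> u'. insertions c y)"
          then have x: "c \<in> set x" "distinct (remove1 c x)" "set (remove1 c x) = set u - {c}"
            "subseq \<pi> (remove1 c x)"
            using u' by (auto simp: arrangements_def insertions_def)
          have "c \<notin> set (remove1 c x)" using x(3) by simp
          with x(1,2) have "distinct x"
            by (induction x) (auto split: if_splits)
          then show "x \<in> arrangements \<pi> u"
            using x c by (auto simp: arrangements_def subseq_remove1_iff)
        qed
        moreover have "insertions c y \<inter> insertions c y' = {}" if "y \<noteq> y'" for y y'
          using that by (auto simp: insertions_def)
        ultimately show ?thesis
          using fin finite_arrangements[of \<pi> u'] by (simp add: sum.UNION_disjoint)
      qed
      have "val (app (words.shuffle m k) (app (words.push (Suc m)) f)) ((p @ [c]) @ u') =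
          fact k * (\<Sum>\<pi>\<in>subwords k u'. \<Sum>y\<in>arrangements \<pi> u'.
             val (app (words.push (Suc m)) f) ((p @ [c]) @ y))"
        using Suc.IH[OF full] u'(1) by simp
      also have "\<dots> = fact k * (\<Sum>\<pi>\<in>subwords k u'. \<Sum>y\<in>arrangements \<pi> u'.
             \<Sum>x\<in>insertions c y. val f (p @ x))"
        using T by simp
      also have "\<dots> = fact k * (\<Sum>\<pi>\<in>subwords k u'. \<Sum>x\<in>arrangements \<pi> u. val f (p @ x))"
        using arr by simp
      finally show ?thesis by (simp add: u'_def[symmetric] sub)
    qed
    \<comment> \<open>Any of the \<open>k + 1\<close> letters outside \<open>\<pi>\<close> may have been removed first; this turns \<open>k!\<close> into \<open>(k + 1)!\<close>.\<close>
    have count: "card {c \<in> set u. c \<notin> set \<pi>} = Suc k" if "\<pi> \<in> subwords (Suc k) u" for \<pi>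
    proof -
      have "subseq \<pi> u" and l: "length \<pi> + Suc k = length u" using that by (auto simp: subwords_def)
      then have "set \<pi> \<subseteq> set u" "distinct \<pi>" using d subseq_set subseq_distinct by blast+
      moreover have "{c \<in> set u. c \<notin> set \<pi>} = set u - set \<pi>" by auto
      ultimately show ?thesis using d l by (simp add: card_Diff_subset distinct_card)
    qed
    let ?S = "\<lambda>\<pi>. \<Sum>x\<in>arrangements \<pi> u. val f (p @ x)"
    have "val (app (words.shuffle (length u) (Suc k)) f) (p @ u)
      = (\<Sum>c\<in>set u. val (app (words.shuffle m k) (app (words.push (Suc m)) f)) (p @ c # remove1 c u))"
      using val_pull[OF Suc.prems, of "app (words.shuffle m k) (app (words.push (Suc m)) f)"] by (simp add: m)
    also have "\<dots> = (\<Sum>c\<in>set u. fact k * (\<Sum>\<pi>\<in>{\<pi> \<in> subwords (Suc k) u. c \<notin> set \<pi>}. ?S \<pi>))"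
      using step by simp
    also have "\<dots> = fact k * (\<Sum>c\<in>set u. \<Sum>\<pi>\<in>{\<pi> \<in> subwords (Suc k) u. c \<notin> set \<pi>}. ?S \<pi>)"
      by (simp add: sum_distrib_left)
    also have "(\<Sum>c\<in>set u. \<Sum>\<pi>\<in>{\<pi> \<in> subwords (Suc k) u. c \<notin> set \<pi>}. ?S \<pi>)
       = (\<Sum>\<pi>\<in>subwords (Suc k) u. \<Sum>c\<in>{c \<in> set u. c \<notin> set \<pi>}. ?S \<pi>)"
      by (rule sum.swap_restrict) (auto simp: finite_subwords)
    also have "\<dots> = of_nat (Suc k) * (\<Sum>\<pi>\<in>subwords (Suc k) u. ?S \<pi>)"
      using count by (simp add: sum_distrib_left del: of_nat_Suc)
    finally show ?thesis by (simp add: algebra_simps)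
  qed
qed

lemma ind_vec_inner:
  "f \<bullet> ind_vec (perms_containing \<pi>) = (\<Sum>x\<in>{x. full_word x \<and> subseq \<pi> x}. val f x)"
  for f :: "real ^ ('n::{finite,linorder} perm)"
proof -
  have "f \<bullet> ind_vec (perms_containing \<pi>) = (\<Sum>\<sigma>\<in>perms_containing \<pi>. f $ \<sigma>)"
    by (simp add: inner_vec_def ind_vec_def indicator_def if_distrib cong: if_cong)
  also have "\<dots> = (\<Sum>x\<in>perm_word ` perms_containing \<pi>. val f x)"
    by (subst sum.reindex) (auto intro: inj_on_subset[OF inj_perm_word])
  also have "perm_word ` perms_containing \<pi> = {x :: 'n list. full_word x \<and> subseq \<pi> x}"
  proof (intro set_eqI iffI)
    fix x assume "x \<in> {x :: 'n list. full_word x \<and> subseq \<pi> x}"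
    then show "x \<in> perm_word ` perms_containing \<pi>"
      using perm_word_surj[of x] by (auto simp: perms_containing_def image_iff)
  qed (auto simp: perms_containing_def full_perm_word)
  finally show ?thesis .
qed

lemma ind_vec_nth: "ind_vec S $ x = (if x \<in> S then 1 else 0)"
  by (simp add: ind_vec_def)

lemma finite_inj_words: "finite (inj_words k :: 'n::finite list set)"
  by (rule finite_subset[OF _ finite_subset_distinct[of UNIV]]) (auto simp: inj_words_def)

lemma R_mat_nth:
  "R_mat k f $ \<sigma> = fact (CARD('n) - k) * (fact k / fact CARD('n))\<^sup>2 *
     (\<Sum>\<pi>\<in>{\<pi>. subseq \<pi> (perm_word \<sigma>) \<and> length \<pi> = k}.
        f \<bullet> ind_vec (perms_containing \<pi>))"
  for \<sigma> :: "'n::{finite,linorder} perm"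
proof -
  have "{\<pi>. subseq \<pi> (perm_word \<sigma>) \<and> length \<pi> = k} = {\<pi> \<in> inj_words k. \<sigma> \<in> perms_containing \<pi>}"
    using full_perm_word[of \<sigma>] by (auto simp: inj_words_def perms_containing_def full_word_def dest: subseq_distinct)
  then show ?thesis
    by (simp add: finite_inj_words R_mat_def sum_component ind_vec_nth if_distrib sum.inter_filter cong: if_cong)
qed

text \<open>
  The factor \<open>(n - k)!\<close> of the transition matrix counts the orders in which the \<open>n - k\<close> cards are taken
  out, and is already part of the shuffle element.
\<close>
lemma R_mat_eq_shuffle:
  assumes "k \<le> CARD('n)"
  shows "R_mat k f = ((fact k / fact CARD('n))\<^sup>2) *\<^sub>R
     app (words.shuffle CARD('n) (CARD('n) - k)) (f :: real ^ ('n::{finite,linorder} perm))"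
proof -
  have "R_mat k f $ \<sigma> = (fact k / fact CARD('n))\<^sup>2 * app (words.shuffle CARD('n) (CARD('n) - k)) f $ \<sigma>"
    for \<sigma> :: "'n perm"
  proof -
    define w where "w = perm_word \<sigma>"
    have w: "full_word w" unfolding w_def by (rule full_perm_word)
    then have l: "length w = CARD('n)" by (simp add: full_word_def)
    have "subwords (CARD('n) - k) w = {\<pi>. subseq \<pi> w \<and> length \<pi> = k}"
      using assms l by (auto simp: subwords_def)
    moreover have "arrangements \<pi> w = {x. full_word x \<and> subseq \<pi> x}" for \<pi>
      using w full_word_set[OF w] full_word_set unfolding arrangements_def full_word_def
      by (auto simp: distinct_card[symmetric])
    ultimately show ?thesis
      using val_shuffle[of "[]" w "CARD('n) - k" f] w l
      by (simp add: R_mat_nth ind_vec_inner w_def[symmetric]) (simp add: w_def)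
  qed
  then show ?thesis by (simp add: vec_eq_iff)
qed

theorem R_mat_commute:
  assumes "j \<le> CARD('n)" "k \<le> CARD('n)"
  shows "R_mat j (R_mat k f) = R_mat k (R_mat j (f :: real ^ ('n::{finite,linorder} perm)))"
proof -
  have "CARD('n) \<le> Suc (CARD('n) - 1)" by simp
  from words.shuffle_commute[OF this, of "CARD('n) - j" "CARD('n) - k"]
  have "app (words.shuffle CARD('n) (CARD('n) - j)) (app (words.shuffle CARD('n) (CARD('n) - k)) f) =
        app (words.shuffle CARD('n) (CARD('n) - k)) (app (words.shuffle CARD('n) (CARD('n) - j)) f)"
    by (metis times_endo.rep_eq)
  then show ?thesis
    using assms by (simp add: R_mat_eq_shuffle linear_scale[OF linear_app] mult.commute)
qed

section \<open>Commuting self-adjoint operators\<close>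

lemma is_direct_sumI:
  fixes E :: "'i \<Rightarrow> 'v::real_inner set"
  assumes I: "finite I" and sub: "\<And>i. i \<in> I \<Longrightarrow> subspace (E i)"
    and orth: "\<And>i j x y. i \<in> I \<Longrightarrow> j \<in> I \<Longrightarrow> i \<noteq> j \<Longrightarrow> x \<in> E i \<Longrightarrow> y \<in> E j \<Longrightarrow> x \<bullet> y = 0"
    and U: "U = span (\<Union>i\<in>I. E i)"
  shows "is_direct_sum I E U"
proof -
  let ?S = "\<lambda>x. \<Sum>i\<in>I. x i"
  have "inj_on ?S (PiE I E)"
  proof (rule inj_onI)
    fix x y assume x: "x \<in> PiE I E" and y: "y \<in> PiE I E" and eq: "?S x = ?S y"
    show "x = y"
    proof (rule PiE_ext[OF x y])
      fix i assume i: "i \<in> I"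
      let ?z = "x i - y i"
      have z: "?z \<in> E i"
        using i x y sub by (auto intro!: subspace_diff)
      have "?z \<bullet> (x j - y j) = (if j = i then ?z \<bullet> ?z else 0)" if "j \<in> I" for j
        using orth[of i j ?z "x j - y j"] that i z x y sub by (auto intro!: subspace_diff)
      then have "(\<Sum>j\<in>I. ?z \<bullet> (x j - y j)) = (\<Sum>j\<in>I. if j = i then ?z \<bullet> ?z else 0)"
        by (rule sum.cong[OF refl])
      then have "(\<Sum>j\<in>I. ?z \<bullet> (x j - y j)) = ?z \<bullet> ?z"
        using i I by simp
      moreover have "(\<Sum>j\<in>I. ?z \<bullet> (x j - y j)) = ?z \<bullet> (?S x - ?S y)"
        by (simp add: inner_sum_right[symmetric] sum_subtractf)
      ultimately show "x i = y i"
        using eq by simp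
    qed
  qed
  moreover have "?S ` PiE I E = U"
  proof
    show "?S ` PiE I E \<subseteq> U"
      unfolding U
    proof (intro image_subsetI span_sum)
      fix x i assume "x \<in> PiE I E" "i \<in> I"
      then show "x i \<in> span (\<Union>i\<in>I. E i)" by (intro span_base) auto
    qed
    have "subspace (?S ` PiE I E)"
    proof (rule subspaceI)
      show "0 \<in> ?S ` PiE I E"
        by (rule image_eqI[of _ _ "\<lambda>i\<in>I. 0"]) (auto simp: sub subspace_0)
    next
      fix a b assume "a \<in> ?S ` PiE I E" "b \<in> ?S ` PiE I E"
      then obtain x y where xy: "x \<in> PiE I E" "y \<in> PiE I E" "a = ?S x" "b = ?S y" by auto
      then show "a + b \<in> ?S ` PiE I E"
        by (intro image_eqI[of _ _ "\<lambda>i\<in>I. x i + y i"])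
          (auto simp: sum.distrib intro!: subspace_add sub)
    next
      fix c a assume "a \<in> ?S ` PiE I E"
      then obtain x where "x \<in> PiE I E" "a = ?S x" by auto
      then show "c *\<^sub>R a \<in> ?S ` PiE I E"
        by (intro image_eqI[of _ _ "\<lambda>i\<in>I. c *\<^sub>R x i"])
          (auto simp: scaleR_sum_right intro!: subspace_scale sub)
    qed
    moreover have "(\<Union>i\<in>I. E i) \<subseteq> ?S ` PiE I E"
    proof clarify
      fix i x assume i: "i \<in> I" "x \<in> E i"
      then show "x \<in> ?S ` PiE I E"
        using I by (intro image_eqI[of _ _ "\<lambda>j\<in>I. if j = i then x else 0"])
          (auto simp: sub subspace_0)
    qed
    ultimately show "U \<subseteq> ?S ` PiE I E"
      unfolding U by (simp add: span_minimal)
  qed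
  ultimately show ?thesis
    using I sub by (simp add: is_direct_sum_def bij_betw_def)
qed

text \<open>
  A maximum point of the Rayleigh quotient on \<open>U\<close> is an eigenvector: otherwise moving from it in
  direction \<open>c v - A v\<close> would have a first-order effect.
\<close>
lemma selfadjoint_eigenvector:
  fixes A :: "'v::euclidean_space \<Rightarrow> 'v"
  assumes lin: "linear A" and sym: "\<And>x y. A x \<bullet> y = x \<bullet> A y"
    and U: "subspace U" "U \<noteq> {0}" and stable: "A ` U \<subseteq> U"
  obtains v c where "v \<in> U" "v \<noteq> 0" "A v = c *\<^sub>R v"
proof -
  let ?S = "U \<inter> sphere 0 1"
  obtain u where u: "u \<in> U" "u \<noteq> 0"
    using U subspace_0 by blast
  then have "u /\<^sub>R norm u \<in> ?S"
    using U(1) by (auto intro: subspace_scale)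
  then have "?S \<noteq> {}" by blast
  moreover have "compact ?S"
    using closed_subspace[OF U(1)] by (intro closed_Int_compact) auto
  moreover have "continuous_on ?S (\<lambda>x. A x \<bullet> x)"
    using lin by (intro continuous_intros linear_continuous_on) (simp add: linear_conv_bounded_linear)
  ultimately obtain v where v: "v \<in> ?S" and max: "\<And>x. x \<in> ?S \<Longrightarrow> A x \<bullet> x \<le> A v \<bullet> v"
    using continuous_attains_sup[of ?S "\<lambda>x. A x \<bullet> x"] by blast
  define c where "c = A v \<bullet> v"
  have vv: "v \<bullet> v = 1" using v by (simp add: norm_eq_1)
  have le: "A w \<bullet> w \<le> c * (w \<bullet> w)" if "w \<in> U" for w
  proof (cases "w = 0")
    case False
    have "w /\<^sub>R norm w \<in> ?S"
      using that False U(1) by (auto intro: subspace_scale)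
    then have "A (w /\<^sub>R norm w) \<bullet> (w /\<^sub>R norm w) \<le> c"
      using max c_def by blast
    then show ?thesis
      using False by (simp add: linear_scale[OF lin] field_simps dot_square_norm power2_eq_square)
  qed (simp add: linear_0[OF lin])
  define w where "w = c *\<^sub>R v - A v"
  have w: "w \<in> U"
    using v stable U(1) by (auto simp: w_def intro!: subspace_diff subspace_scale)
  have "A v = c *\<^sub>R v"
  proof (rule ccontr)
    assume "A v \<noteq> c *\<^sub>R v"
    then have pos: "w \<bullet> w > 0" by (simp add: w_def)
    define g where "g = c * (w \<bullet> w) - A w \<bullet> w"
    have g: "0 \<le> 2 * t * (w \<bullet> w) + t\<^sup>2 * g" for t
    proof -
      have "v + t *\<^sub>R w \<in> U" using v w U(1) by (auto intro!: subspace_add subspace_scale)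
      then have "0 \<le> c * ((v + t *\<^sub>R w) \<bullet> (v + t *\<^sub>R w)) - A (v + t *\<^sub>R w) \<bullet> (v + t *\<^sub>R w)"
        using le by simp
      also have "\<dots> = (c * (v \<bullet> v) - A v \<bullet> v) + 2 * t * (c * (v \<bullet> w) - A v \<bullet> w) + t\<^sup>2 * g"
        using sym[of v w]
        by (simp add: linear_add[OF lin] linear_scale[OF lin] g_def inner_add_left inner_add_right
            inner_commute power2_eq_square algebra_simps)
      also have "c * (v \<bullet> w) - A v \<bullet> w = w \<bullet> w"
        by (simp add: w_def inner_diff_left)
      finally show ?thesis by (simp add: vv c_def)
    qed
    \<comment> \<open>A negative step, small enough for the linear term to beat the quadratic one.\<close>
    define t where "t = - (w \<bullet> w) / (\<bar>g\<bar> + 1)"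
    have t: "t < 0" "t * (\<bar>g\<bar> + 1) = - (w \<bullet> w)" using pos by (auto simp: t_def)
    have "t\<^sup>2 * g \<le> t\<^sup>2 * (\<bar>g\<bar> + 1)" by (intro mult_left_mono) auto
    also have "\<dots> = - t * (w \<bullet> w)" using t(2) by (simp add: power2_eq_square mult.assoc)
    finally have "2 * t * (w \<bullet> w) + t\<^sup>2 * g \<le> t * (w \<bullet> w)" by simp
    also have "\<dots> < 0" using t(1) pos by (simp add: mult_less_0_iff)
    finally show False using g[of t] by simp
  qed
  then show ?thesis
    by (intro that[of v c]) (use v in auto)
qed

locale commuting_selfadjoint =
  fixes A :: "'k \<Rightarrow> 'v::euclidean_space \<Rightarrow> 'v" and K :: "'k set"
  assumes finite_K: "finite K"
    and lin: "k \<in> K \<Longrightarrow> linear (A k)"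
    and sym: "k \<in> K \<Longrightarrow> A k x \<bullet> y = x \<bullet> A k y"
    and comm: "j \<in> K \<Longrightarrow> k \<in> K \<Longrightarrow> A j (A k x) = A k (A j x)"
begin

definition eigvec :: "('k \<Rightarrow> real) \<Rightarrow> 'v \<Rightarrow> bool" where
  "eigvec \<mu> v \<longleftrightarrow> (\<forall>k\<in>K. A k v = \<mu> k *\<^sub>R v)"

text \<open>
  Take an eigenvector of one operator; the other operators preserve its eigenspace, so that the search
  continues there.
\<close>
lemma eigvec_exists:
  assumes "subspace U" "U \<noteq> {0}" "\<And>k. k \<in> K \<Longrightarrow> A k ` U \<subseteq> U"
  obtains v \<mu> where "v \<in> U" "v \<noteq> 0" "eigvec \<mu> v"
proof -
  have "\<exists>v\<in>U. v \<noteq> 0 \<and> (\<exists>\<mu>. \<forall>k\<in>L. A k v = \<mu> k *\<^sub>R v)" if "finite L" "L \<subseteq> K" for L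
    using that assms
  proof (induction L arbitrary: U rule: finite_induct)
    case empty
    then show ?case using subspace_0 by fastforce
  next
    case (insert k L U)
    then have k: "k \<in> K" by simp
    obtain u c where u: "u \<in> U" "u \<noteq> 0" "A k u = c *\<^sub>R u"
      using selfadjoint_eigenvector[OF lin[OF k] sym[OF k]] insert.prems k by metis
    define U' where "U' = U \<inter> {x. A k x = c *\<^sub>R x}"
    have "subspace {x. A k x = c *\<^sub>R x}"
      using lin[OF k] by (intro subspaceI) (auto simp: linear_0 linear_add linear_scale algebra_simps)
    then have "subspace U'"
      unfolding U'_def using insert.prems by (intro subspace_inter)
    moreover have "U' \<noteq> {0}" using u by (auto simp: U'_def)
    moreover have "A j ` U' \<subseteq> U'" if j: "j \<in> K" for j
      using insert.prems(4)[OF j] j k by (auto simp: U'_def comm[OF k j] linear_scale[OF lin[OF j]])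
    ultimately obtain v \<mu> where v: "v \<in> U'" "v \<noteq> 0" "\<forall>j\<in>L. A j v = \<mu> j *\<^sub>R v"
      using insert.IH[of U'] insert.prems(1) by blast
    then have "\<forall>j\<in>insert k L. A j v = (\<mu>(k := c)) j *\<^sub>R v"
      by (auto simp: U'_def)
    moreover have "v \<in> U" using v by (auto simp: U'_def)
    ultimately show ?case using v(2) by blast
  qed
  from this[OF finite_K order_refl] show ?thesis
    using that unfolding eigvec_def by blast
qed

lemma orthogonal_comp_stable:
  assumes "k \<in> K" "A k ` U \<subseteq> U"
  shows "A k ` orthogonal_comp U \<subseteq> orthogonal_comp U"
proof (rule image_subsetI)
  fix x assume x: "x \<in> orthogonal_comp U"
  have "y \<bullet> A k x = 0" if "y \<in> U" for y
  proof -
    have "A k y \<in> U" using that assms(2) by blast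
    then show ?thesis
      using x sym[OF assms(1), of y x] by (simp add: orthogonal_comp_def orthogonal_def)
  qed
  then show "A k x \<in> orthogonal_comp U"
    by (simp add: orthogonal_comp_def orthogonal_def)
qed

text \<open>
  The vectors of \<open>U\<close> orthogonal to all common eigenvectors in \<open>U\<close> form a stable subspace, which would
  contain another common eigenvector if it were not zero.
\<close>
lemma span_eigvec:
  assumes "subspace U" "\<And>k. k \<in> K \<Longrightarrow> A k ` U \<subseteq> U"
  shows "U \<subseteq> span {v \<in> U. \<exists>\<mu>. eigvec \<mu> v}"
proof -
  define E where "E = span {v \<in> U. \<exists>\<mu>. eigvec \<mu> v}"
  have "A k ` E \<subseteq> E" if k: "k \<in> K" for k
  proof -
    have "A k ` E = span (A k ` {v \<in> U. \<exists>\<mu>. eigvec \<mu> v})"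
      unfolding E_def by (rule linear_span_image[OF lin[OF k], symmetric])
    also have "\<dots> \<subseteq> E"
      unfolding E_def
    proof (intro span_minimal subspace_span image_subsetI)
      fix v assume v: "v \<in> {v \<in> U. \<exists>\<mu>. eigvec \<mu> v}"
      then obtain \<mu> where "A k v = \<mu> k *\<^sub>R v" using k by (auto simp: eigvec_def)
      then show "A k v \<in> span {v \<in> U. \<exists>\<mu>. eigvec \<mu> v}"
        using v by (simp add: span_base span_scale)
    qed
    finally show ?thesis .
  qed
  then have stable: "A k ` (U \<inter> orthogonal_comp E) \<subseteq> U \<inter> orthogonal_comp E" if "k \<in> K" for k
    using assms(2)[OF that] orthogonal_comp_stable[OF that, of E] that by (simp add: image_subset_iff)
  have "U \<inter> orthogonal_comp E = {0}"
  proof (rule ccontr)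
    assume "U \<inter> orthogonal_comp E \<noteq> {0}"
    moreover have "subspace (U \<inter> orthogonal_comp E)"
      using assms(1) by (intro subspace_inter subspace_orthogonal_comp)
    ultimately obtain v \<mu> where v: "v \<in> U" "v \<in> orthogonal_comp E" "v \<noteq> 0" "eigvec \<mu> v"
      using eigvec_exists[OF _ _ stable] by blast
    then have "v \<in> E" by (auto simp: E_def intro: span_base)
    then show False using v by (auto simp: orthogonal_comp_def orthogonal_def)
  qed
  moreover have "E \<subseteq> U" unfolding E_def using assms(1) by (intro span_minimal) auto
  moreover have "u \<in> E" if u: "u \<in> U" for u
  proof -
    obtain y z where yz: "y \<in> E" "\<And>w. w \<in> E \<Longrightarrow> orthogonal z w" "u = y + z"
      using orthogonal_subspace_decomp_exists[of "{v \<in> U. \<exists>\<mu>. eigvec \<mu> v}" u, folded E_def] by blast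
    then have "z \<in> U" using u \<open>E \<subseteq> U\<close> assms(1) subspace_diff[of U u y] by auto
    moreover have "z \<in> orthogonal_comp E" using yz by (auto simp: orthogonal_comp_def orthogonal_commute)
    ultimately have "z = 0" using \<open>U \<inter> orthogonal_comp E = {0}\<close> by blast
    then show ?thesis using yz by simp
  qed
  ultimately show ?thesis unfolding E_def by blast
qed

definition eigenspaces :: "'v set set" where
  "eigenspaces = {S. S \<noteq> {0} \<and> (\<exists>\<mu>. S = {v. eigvec \<mu> v})}"

lemma subspace_eigvec: "subspace {v. eigvec \<mu> v}"
  by (intro subspaceI) (auto simp: eigvec_def linear_0[OF lin] linear_add[OF lin] linear_scale[OF lin] algebra_simps)

lemma eigenspaces_orthogonal:
  assumes "S \<in> eigenspaces" "S' \<in> eigenspaces" "S \<noteq> S'" "x \<in> S" "y \<in> S'"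
  shows "x \<bullet> y = 0"
proof (rule ccontr)
  assume xy: "x \<bullet> y \<noteq> 0"
  obtain \<mu> \<mu>' where S: "S = {v. eigvec \<mu> v}" "S' = {v. eigvec \<mu>' v}"
    using assms by (auto simp: eigenspaces_def)
  have "\<mu> k = \<mu>' k" if "k \<in> K" for k
    using sym[OF that, of x y] assms(4,5) that xy by (simp add: S eigvec_def)
  then have "S = S'" by (auto simp: S eigvec_def)
  with assms show False by simp
qed

text \<open>
  Nonzero vectors chosen from distinct eigenspaces are pairwise orthogonal, so there are at most as many
  as the dimension.
\<close>
lemma finite_eigenspaces: "finite eigenspaces"
proof -
  have "\<exists>x\<in>S. x \<noteq> 0" if "S \<in> eigenspaces" for S
    using that subspace_eigvec subspace_0 unfolding eigenspaces_def by blast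
  then obtain p where p: "\<And>S. S \<in> eigenspaces \<Longrightarrow> p S \<in> S \<and> p S \<noteq> 0" by metis
  have "pairwise orthogonal (p ` eigenspaces)"
    using p eigenspaces_orthogonal unfolding pairwise_def orthogonal_def by blast
  then have "finite (p ` eigenspaces)"
    by (rule pairwise_orthogonal_imp_finite)
  moreover have "inj_on p eigenspaces"
    using p eigenspaces_orthogonal by (intro inj_onI) (metis inner_eq_zero_iff)
  ultimately show ?thesis by (rule finite_imageD)
qed

text \<open>
  The summands are eigenspaces in the whole space, not their intersections with \<open>U\<close>; this is what the
  assumption \<open>whole\<close> is for.
\<close>
lemma direct_sum_eigenspaces:
  assumes U: "subspace U" "\<And>k. k \<in> K \<Longrightarrow> A k ` U \<subseteq> U"
    and whole: "\<And>\<mu> v w. v \<in> U \<Longrightarrow> v \<noteq> 0 \<Longrightarrow> eigvec \<mu> v \<Longrightarrow> eigvec \<mu> w \<Longrightarrow> w \<in> U"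
  shows "is_direct_sum {S \<in> eigenspaces. S \<subseteq> U} (\<lambda>S. S) U"
proof -
  have "U = span (\<Union>S\<in>{S \<in> eigenspaces. S \<subseteq> U}. S)"
  proof
    have "{v \<in> U. \<exists>\<mu>. eigvec \<mu> v} - {0} \<subseteq> (\<Union>S\<in>{S \<in> eigenspaces. S \<subseteq> U}. S)"
    proof
      fix v assume "v \<in> {v \<in> U. \<exists>\<mu>. eigvec \<mu> v} - {0}"
      then obtain \<mu> where "v \<in> U" "eigvec \<mu> v" "v \<noteq> 0" by auto
      then have "{w. eigvec \<mu> w} \<in> {S \<in> eigenspaces. S \<subseteq> U}" "v \<in> {w. eigvec \<mu> w}"
        using whole[of v \<mu>] by (auto simp: eigenspaces_def)
      then show "v \<in> (\<Union>S\<in>{S \<in> eigenspaces. S \<subseteq> U}. S)" by blast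
    qed
    then have "span ({v \<in> U. \<exists>\<mu>. eigvec \<mu> v} - {0}) \<subseteq> span (\<Union>S\<in>{S \<in> eigenspaces. S \<subseteq> U}. S)"
      by (rule span_mono)
    then show "U \<subseteq> span (\<Union>S\<in>{S \<in> eigenspaces. S \<subseteq> U}. S)"
      using span_eigvec[OF U] by (simp add: span_delete_0)
    show "span (\<Union>S\<in>{S \<in> eigenspaces. S \<subseteq> U}. S) \<subseteq> U"
      using U(1) by (intro span_minimal) auto
  qed
  moreover have "finite {S \<in> eigenspaces. S \<subseteq> U}"
    using finite_eigenspaces by simp
  moreover have "subspace S" if "S \<in> eigenspaces" for S
    using that subspace_eigvec by (auto simp: eigenspaces_def)
  ultimately show ?thesis
    by (intro is_direct_sumI[where E="\<lambda>S. S"]) (blast intro: eigenspaces_orthogonal | simp)+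
qed

end

section \<open>The kernels of the transition matrices\<close>

lemma linear_R_mat: "linear (R_mat k :: real ^ ('n::{finite,linorder} perm) \<Rightarrow> _)"
  by (rule linearI)
    (simp_all add: R_mat_def inner_add_left scaleR_add_left scaleR_add_right sum.distrib scaleR_sum_right mult_ac)

lemma R_mat_inner:
  "R_mat k f \<bullet> g = fact (CARD('n) - k) * (fact k / fact CARD('n))\<^sup>2 *
    (\<Sum>\<pi>\<in>inj_words k. (f \<bullet> ind_vec (perms_containing \<pi>)) * (g \<bullet> ind_vec (perms_containing \<pi>)))"
  for f g :: "real ^ ('n::{finite,linorder} perm)"
  by (simp add: R_mat_def inner_sum_left inner_commute[of "ind_vec _" g])

lemma R_mat_sym: "R_mat k f \<bullet> g = f \<bullet> R_mat k g"
  for f g :: "real ^ ('n::{finite,linorder} perm)"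
proof -
  have "R_mat k f \<bullet> g = R_mat k g \<bullet> f"
    unfolding R_mat_inner by (rule arg_cong[of _ _ "(*) _"], rule sum.cong) (rule refl, rule mult.commute)
  then show ?thesis by (simp only: inner_commute[of f])
qed

text \<open>
  The only word of length 0 is contained in every permutation, so \<open>V_space 0\<close> follows the general
  pattern and what holds for all \<open>V_space k\<close> covers the constants, too.
\<close>
lemma V_space_eq: "V_space k = span ((\<lambda>\<pi>. ind_vec (perms_containing \<pi>)) ` inj_words k)"
proof (cases "k = 0")
  case True
  then have "inj_words k = {[] :: 'a list}" by (auto simp: inj_words_def)
  moreover have "perms_containing [] = (UNIV :: 'a perm set)" by (simp add: perms_containing_def)
  ultimately show ?thesis using True by (simp add: V_space_def)
next
  case False
  then show ?thesis by (simp add: V_space_def Setcompr_eq_image)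
qed

lemma subspace_V_space: "subspace (V_space k)"
  by (simp add: V_space_eq)

lemma R_mat_in_V_space: "R_mat k f \<in> V_space k"
  unfolding R_mat_def V_space_eq by (intro span_scale span_sum span_base imageI)

text \<open>
  \<open>R_mat k f \<bullet> f\<close> is a positive multiple of the sum of the squares of the inner products of \<open>f\<close> with the
  vectors that span \<open>V_space k\<close>.
\<close>
lemma ker_R_mat: "{f. R_mat k f = 0} = orthogonal_comp (V_space k :: (real ^ ('n::{finite,linorder} perm)) set)"
proof (intro set_eqI iffI)
  fix f :: "real ^ ('n perm)"
  assume "f \<in> {f. R_mat k f = 0}"
  then have "(\<Sum>\<pi>\<in>inj_words k. (f \<bullet> ind_vec (perms_containing \<pi>)) * (f \<bullet> ind_vec (perms_containing \<pi>))) = 0"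
    using R_mat_inner[of k f f] by simp
  then have "\<forall>\<pi>\<in>inj_words k. f \<bullet> ind_vec (perms_containing \<pi>) = 0"
    using finite_inj_words by (subst (asm) sum_nonneg_eq_0_iff) auto
  then have "orthogonal f y" if "y \<in> span ((\<lambda>\<pi>. ind_vec (perms_containing \<pi>)) ` inj_words k)" for y
    using orthogonal_to_span[OF that, of f] by (auto simp: orthogonal_def)
  then show "f \<in> orthogonal_comp (V_space k)"
    by (auto simp: orthogonal_comp_def orthogonal_commute V_space_eq)
next
  fix f :: "real ^ ('n perm)"
  assume "f \<in> orthogonal_comp (V_space k)"
  then have "ind_vec (perms_containing \<pi>) \<bullet> f = 0" if "\<pi> \<in> inj_words k" for \<pi>
    using that unfolding V_space_eq
    by (auto simp: orthogonal_comp_def orthogonal_def intro: span_base)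
  then have "f \<bullet> ind_vec (perms_containing \<pi>) = 0" if "\<pi> \<in> inj_words k" for \<pi>
    using that by (simp add: inner_commute)
  then show "f \<in> {f. R_mat k f = 0}" by (simp add: R_mat_def)
qed

text \<open>
  By commutation \<open>R_mat k\<close> preserves the kernel of \<open>R_mat j\<close>, which is the orthogonal complement of
  \<open>V_space j\<close>.
\<close>
lemma R_mat_stable_V_space:
  assumes "j \<le> CARD('n)" "k \<le> CARD('n)"
  shows "R_mat k ` V_space j \<subseteq> (V_space j :: (real ^ ('n::{finite,linorder} perm)) set)"
proof -
  interpret commuting_selfadjoint "R_mat :: nat \<Rightarrow> real ^ ('n perm) \<Rightarrow> _" "{j, k}"
    by (rule commuting_selfadjoint.intro) (use assms in \<open>auto simp: linear_R_mat R_mat_sym intro: R_mat_commute\<close>)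
  have "R_mat k ` {f. R_mat j f = 0} \<subseteq> {f. R_mat j f = (0 :: real ^ ('n perm))}"
    by (auto simp: R_mat_commute[OF assms] linear_0[OF linear_R_mat])
  then have "R_mat k ` orthogonal_comp (V_space j) \<subseteq> orthogonal_comp (V_space j :: (real ^ ('n perm)) set)"
    unfolding ker_R_mat .
  then show ?thesis
    using orthogonal_comp_stable[of k "orthogonal_comp (V_space j)"]
    by (simp add: orthogonal_comp_self subspace_V_space)
qed

text \<open>
  Let \<open>a\<close> be a letter outside \<open>\<pi>\<close>.  A permutation that contains \<open>\<pi>\<close> contains exactly one of the words
  obtained by inserting \<open>a\<close> into \<open>\<pi>\<close>, so the indicator of \<open>\<pi>\<close> is the sum of the indicators of these words.
\<close>
lemma V_space_Suc:
  assumes "k < CARD('n)"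
  shows "V_space k \<subseteq> (V_space (Suc k) :: (real ^ ('n::{finite,linorder} perm)) set)"
  unfolding V_space_eq[of k]
proof (intro span_minimal subspace_V_space image_subsetI)
  fix \<pi> :: "'n list" assume "\<pi> \<in> inj_words k"
  then have \<pi>: "distinct \<pi>" "length \<pi> = k" by (auto simp: inj_words_def)
  then have "set \<pi> \<noteq> UNIV" using assms by (metis distinct_card less_irrefl)
  then obtain a where a: "a \<notin> set \<pi>" by auto
  have one: "ind_vec (perms_containing \<pi>) $ \<sigma> =
     (\<Sum>\<rho>\<in>insertions a \<pi>. ind_vec (perms_containing \<rho>) $ \<sigma>)" for \<sigma> :: "'n perm"
  proof -
    define w where "w = perm_word \<sigma>"
    have w: "distinct w" "set w = UNIV"
      using full_perm_word[of \<sigma>] full_word_set by (auto simp: w_def full_word_def)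
    have filter_eq: "filter (\<lambda>x. x \<in> set \<rho>) w = \<rho>" if "subseq \<rho> w" for \<rho>
      using that w filter_in_nths by (auto simp: subseq_conv_nths)
    define \<rho>0 where "\<rho>0 = filter (\<lambda>x. x \<in> insert a (set \<pi>)) w"
    have "{\<rho> \<in> insertions a \<pi>. subseq \<rho> w} = (if subseq \<pi> w then {\<rho>0} else {})"
    proof -
      have "\<rho> = \<rho>0 \<and> subseq \<pi> w" if "\<rho> \<in> insertions a \<pi>" "subseq \<rho> w" for \<rho>
      proof -
        have d: "distinct \<rho>" using that(2) w subseq_distinct by blast
        have "a \<in> set \<rho>" "remove1 a \<rho> = \<pi>" using that by (auto simp: insertions_def)
        then have "set \<rho> = insert a (set \<pi>)" using d by auto
        moreover have "subseq \<pi> \<rho>"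
          using \<open>remove1 a \<rho> = \<pi>\<close> d subseq_remove1_iff[of \<rho> \<pi> a] by simp
        ultimately show ?thesis
          using filter_eq[OF that(2)] that(2) subseq_order.trans by (auto simp: \<rho>0_def)
      qed
      moreover have "\<rho>0 \<in> insertions a \<pi> \<and> subseq \<rho>0 w" if "subseq \<pi> w"
      proof -
        have "remove1 a \<rho>0 = filter (\<lambda>x. x \<in> set \<pi>) w"
          using a w by (auto simp: \<rho>0_def distinct_remove1_removeAll removeAll_filter_not_eq intro!: filter_cong)
        then show ?thesis
          using filter_eq[OF that] w by (auto simp: insertions_def \<rho>0_def)
      qed
      ultimately show ?thesis by auto
    qed
    then show ?thesis
      using finite_insertions[OF a]
      by (simp add: ind_vec_nth perms_containing_def w_def[symmetric] sum.inter_filter[symmetric])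
  qed
  have "ind_vec (perms_containing \<pi>) = (\<Sum>\<rho>\<in>insertions a \<pi>. ind_vec (perms_containing \<rho> :: 'n perm set))"
    by (simp add: vec_eq_iff one)
  also have "\<dots> \<in> V_space (Suc k)"
    unfolding V_space_eq
  proof (intro span_sum span_base imageI)
    fix \<rho> assume "\<rho> \<in> insertions a \<pi>"
    then have "a \<in> set \<rho>" "remove1 a \<rho> = \<pi>" by (auto simp: insertions_def)
    then have "mset \<rho> = add_mset a (mset \<pi>)" by (metis insert_DiffM mset_remove1 set_mset_mset)
    then have "mset \<rho> = mset (a # \<pi>)" by simp
    then have "distinct \<rho>" "length \<rho> = Suc k"
      using \<pi> a by (metis distinct.simps(2) mset_eq_imp_distinct_iff, metis length_Cons mset_eq_length)
    then show "\<rho> \<in> inj_words (Suc k)" by (simp add: inj_words_def)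
  qed
  finally show "ind_vec (perms_containing \<pi>) \<in> (V_space (Suc k) :: (real ^ ('n perm)) set)" .
qed

lemma V_space_mono:
  assumes "j \<le> k" "k \<le> CARD('n)"
  shows "V_space j \<subseteq> (V_space k :: (real ^ ('n::{finite,linorder} perm)) set)"
  using assms
proof (induction k rule: dec_induct)
  case (step k)
  then show ?case using V_space_Suc[of k, where 'n='n] by auto
qed simp

lemma V_space_CARD: "V_space CARD('n) = (UNIV :: (real ^ ('n::{finite,linorder} perm)) set)"
proof -
  have "f \<in> V_space CARD('n)" for f :: "real ^ ('n perm)"
  proof -
    have "axis \<sigma> 1 = ind_vec (perms_containing (perm_word \<sigma>))" for \<sigma> :: "'n perm"
    proof -
      have "perms_containing (perm_word \<sigma>) = {\<sigma>}"
      proof -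
        have "\<tau> = \<sigma>" if "subseq (perm_word \<sigma>) (perm_word \<tau>)" for \<tau> :: "'n perm"
        proof -
          have "perm_word \<sigma> = perm_word \<tau>"
            using subseq_same_length[OF that] full_perm_word[of \<sigma>] full_perm_word[of \<tau>]
            by (simp add: full_word_def)
          then show ?thesis by (metis injD inj_perm_word)
        qed
        then show ?thesis by (auto simp: perms_containing_def)
      qed
      then show ?thesis by (auto simp: vec_eq_iff axis_def ind_vec_nth)
    qed
    moreover have "perm_word \<sigma> \<in> inj_words CARD('n)" for \<sigma> :: "'n perm"
      using full_perm_word[of \<sigma>] by (simp add: inj_words_def full_word_def)
    ultimately have "axis \<sigma> 1 \<in> (V_space CARD('n) :: (real ^ ('n perm)) set)" for \<sigma>
      unfolding V_space_eq by (simp add: span_base)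
    then have "(\<Sum>\<sigma>\<in>UNIV. (f $ \<sigma>) *\<^sub>R axis \<sigma> 1) \<in> V_space CARD('n)"
      by (intro subspace_sum subspace_scale subspace_V_space)
    then show ?thesis
      using basis_expansion[of f] by (simp add: scalar_mult_eq_scaleR)
  qed
  then show ?thesis by blast
qed

section \<open>The orthogonal decomposition and its eigenspaces\<close>

lemma subseq_pair: "distinct y \<Longrightarrow> a \<in> set y \<Longrightarrow> b \<in> set y \<Longrightarrow> a \<noteq> b \<Longrightarrow> subseq [a, b] y \<or> subseq [b, a] y"
  by (induction y) (auto simp: subseq_singleton_left)

text \<open>
  A maximum principle.  If \<open>f\<close> has the eigenvalue of the constants, then \<open>g = max f - f\<close> is a nonnegative
  eigenvector with a zero, and a zero of \<open>g\<close> at a word forces zeros at all words that share an ordered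
  pair of letters with it.  Two such steps reach every word: from \<open>a b d w\<close>, a word with \<open>b\<close> before \<open>d\<close> is
  reached directly, and one with \<open>d\<close> before \<open>b\<close> through \<open>a d b w\<close>.
\<close>
lemma R_mat_2_constant:
  fixes f :: "real ^ ('n::{finite,linorder} perm)"
  assumes n: "3 \<le> CARD('n)"
    and one: "R_mat 2 (ind_vec UNIV) = c *\<^sub>R (ind_vec UNIV :: real ^ ('n perm))"
    and f: "R_mat 2 f = c *\<^sub>R f"
  shows "f \<in> V_space 0"
proof -
  obtain \<sigma> where \<sigma>: "\<And>\<tau>. f $ \<tau> \<le> f $ \<sigma>"
  proof -
    have "Max (range (($) f)) \<in> range (($) f)" by (intro Max_in) auto
    then obtain \<sigma> where "f $ \<sigma> = Max (range (($) f))" by (metis imageE)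
    then show ?thesis by (intro that[of \<sigma>]) simp
  qed
  define g where "g = (f $ \<sigma>) *\<^sub>R ind_vec UNIV - f"
  have g0: "0 \<le> g $ \<tau>" "g $ \<sigma> = 0" for \<tau> using \<sigma> by (auto simp: g_def ind_vec_nth)
  then have val0: "0 \<le> val g x" for x by (simp add: val_def)
  have Rg: "R_mat 2 g = c *\<^sub>R g"
    by (simp add: g_def linear_diff[OF linear_R_mat] linear_scale[OF linear_R_mat] one f algebra_simps)
  have step: "val g y = 0"
    if "full_word x" "full_word y" "val g x = 0" "length \<pi> = 2" "subseq \<pi> x" "subseq \<pi> y" for x y \<pi>
  proof -
    obtain \<tau> where \<tau>: "perm_word \<tau> = x" using perm_word_surj[OF \<open>full_word x\<close>] .
    then have "R_mat 2 g $ \<tau> = 0" using that Rg by (metis val_perm_word vector_scaleR_component mult_zero_right real_scaleR_def)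
    then have sum0: "(\<Sum>\<pi>\<in>{\<pi>. subseq \<pi> x \<and> length \<pi> = 2}. g \<bullet> ind_vec (perms_containing \<pi>)) = 0"
      unfolding R_mat_nth \<tau> by simp
    have "finite {\<pi>. subseq \<pi> x \<and> length \<pi> = 2}"
      by (rule finite_subset[of _ "set (subseqs x)"]) auto
    moreover have "0 \<le> g \<bullet> ind_vec (perms_containing \<pi>)" for \<pi>
      unfolding ind_vec_inner by (intro sum_nonneg val0)
    ultimately have "g \<bullet> ind_vec (perms_containing \<pi>) = 0"
      using sum0 that by (subst (asm) sum_nonneg_eq_0_iff) auto
    moreover have "finite {x :: 'n list. full_word x \<and> subseq \<pi> x}"
      by (rule finite_subset[OF _ finite_subset_distinct[of UNIV]]) (auto simp: full_word_def)
    ultimately show ?thesis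
      using that val0 unfolding ind_vec_inner by (subst (asm) sum_nonneg_eq_0_iff) auto
  qed
  have "g $ \<tau> = 0" for \<tau>
  proof -
    define x y where "x = perm_word \<sigma>" and "y = perm_word \<tau>"
    have x: "full_word x" "val g x = 0" and y: "full_word y"
      using g0 by (auto simp: x_def y_def full_perm_word)
    have "length x = CARD('n)" using x by (simp add: full_word_def)
    then obtain a b d w where xe: "x = a # b # d # w"
      using n by (metis Suc_le_length_iff numeral_3_eq_3)
    then have bd: "b \<noteq> d" using x(1) by (simp add: full_word_def)
    have "subseq [b, d] y \<or> subseq [d, b] y"
      using y bd by (intro subseq_pair) (auto simp: full_word_set full_word_def)
    then have "val g y = 0"
    proof
      assume "subseq [b, d] y"
      then show ?thesis
        using step[OF x(1) y x(2), of "[b, d]"] by (simp add: xe subseq_singleton_left)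
    next
      assume *: "subseq [d, b] y"
      have z: "full_word (a # d # b # w)"
        by (rule full_word_perm[OF x(1)]) (use x(1) in \<open>auto simp: xe full_word_def\<close>)
      have "val g (a # d # b # w) = 0"
        using step[OF x(1) z x(2), of "[a, b]"] by (simp add: xe subseq_singleton_left)
      then show ?thesis
        using step[OF z y, of "[d, b]"] * by (simp add: subseq_singleton_left)
    qed
    then show ?thesis by (simp add: y_def)
  qed
  then have "g = 0" by (simp add: vec_eq_iff)
  then have "f = (f $ \<sigma>) *\<^sub>R ind_vec UNIV" by (simp add: g_def)
  then show ?thesis
    by (metis V_space_def span_base span_scale singletonI)
qed

lemma subspace_W_space: "subspace (W_space k)"
  unfolding W_space_def by (intro subspace_inter subspace_V_space subspace_orthogonal_comp)

lemma V_Int_orthogonal_comp: "f \<in> V_space k \<Longrightarrow> f \<in> orthogonal_comp (V_space k) \<Longrightarrow> f = 0"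
  by (auto simp: orthogonal_comp_def orthogonal_def)

lemma W_space_orthogonal:
  assumes "2 \<le> i" "i < j" "j \<le> CARD('n)" "x \<in> W_space i" "y \<in> (W_space j :: (real ^ ('n::{finite,linorder} perm)) set)"
  shows "x \<bullet> y = 0"
proof -
  have "x \<in> V_space (j - 1)"
  proof -
    have "V_space i \<subseteq> (V_space (j - 1) :: (real ^ ('n perm)) set)"
      by (rule V_space_mono) (use assms in auto)
    then show ?thesis using assms by (auto simp: W_space_def)
  qed
  then show ?thesis
    using assms by (auto simp: W_space_def orthogonal_comp_def orthogonal_def)
qed

lemma orthogonal_comp_decomp:
  fixes f :: "real ^ ('n::{finite,linorder} perm)"
  assumes k: "2 \<le> k" and "k \<le> m" "m \<le> CARD('n)" "f \<in> V_space m" "f \<in> orthogonal_comp (V_space k)"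
  shows "f \<in> span (\<Union>j\<in>{k+1..m}. W_space j)"
  using assms(2-5)
proof (induction m arbitrary: f rule: dec_induct)
  case base
  then show ?case using V_Int_orthogonal_comp span_zero by metis
next
  case (step m)
  obtain y z where yz: "y \<in> V_space m" "\<And>w. w \<in> V_space m \<Longrightarrow> orthogonal z w" "f = y + z"
  proof -
    have "span (V_space m) = (V_space m :: (real ^ ('n perm)) set)"
      using subspace_V_space by (simp add: span_eq_iff)
    then show ?thesis
      using orthogonal_subspace_decomp_exists[of "V_space m" f] that by metis
  qed
  have mono: "V_space k \<subseteq> (V_space m :: (real ^ ('n perm)) set)" "V_space m \<subseteq> (V_space (Suc m) :: (real ^ ('n perm)) set)"
    using step V_space_mono[of k m, where 'n='n] V_space_Suc[of m, where 'n='n] by auto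
  have "z \<in> orthogonal_comp (V_space m)"
    using yz by (auto simp: orthogonal_comp_def orthogonal_commute)
  moreover have "z \<in> V_space (Suc m)"
    using yz mono step.prems subspace_diff[OF subspace_V_space, of f "Suc m" y] by auto
  ultimately have "z \<in> W_space (Suc m)"
    using step.hyps k by (simp add: W_space_def)
  then have z: "z \<in> span (\<Union>j\<in>{k+1..Suc m}. W_space j)"
    using step.hyps by (intro span_base) auto
  have "z \<in> orthogonal_comp (V_space k)"
    using \<open>z \<in> orthogonal_comp (V_space m)\<close> mono by (auto simp: orthogonal_comp_def)
  then have "y \<in> orthogonal_comp (V_space k)"
    using step.prems yz subspace_diff[OF subspace_orthogonal_comp, of f "V_space k" z] by auto
  then have "y \<in> span (\<Union>j\<in>{k+1..m}. W_space j)"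
    using step yz by auto
  also have "\<dots> \<subseteq> span (\<Union>j\<in>{k+1..Suc m}. W_space j)"
    by (intro span_mono UN_mono) auto
  finally show ?case using z yz by (simp add: span_add)
qed

lemma ker_R_mat_direct_sum:
  assumes "2 \<le> k" "k \<le> CARD('n)"
  shows "is_direct_sum {k+1..CARD('n)} W_space {f :: real ^ ('n::{finite,linorder} perm). R_mat k f = 0}"
proof (rule is_direct_sumI)
  show "x \<bullet> y = 0" if "i \<in> {k+1..CARD('n)}" "j \<in> {k+1..CARD('n)}" "i \<noteq> j"
    "x \<in> W_space i" "y \<in> W_space j" for i j and x y :: "real ^ ('n perm)"
  proof (cases "i < j")
    case True
    then show ?thesis using that assms by (intro W_space_orthogonal[of i j]) auto
  next
    case False
    then have "y \<bullet> x = 0" using that assms by (intro W_space_orthogonal[of j i]) auto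
    then show ?thesis by (simp add: inner_commute)
  qed
  show "{f :: real ^ ('n perm). R_mat k f = 0} = span (\<Union>j\<in>{k+1..CARD('n)}. W_space j)"
    unfolding ker_R_mat
  proof
    show "orthogonal_comp (V_space k) \<subseteq> span (\<Union>j\<in>{k+1..CARD('n)}. W_space j :: (real ^ ('n perm)) set)"
      using orthogonal_comp_decomp[OF assms order_refl] by (auto simp: V_space_CARD)
    have "W_space j \<subseteq> orthogonal_comp (V_space k :: (real ^ ('n perm)) set)" if "j \<in> {k+1..CARD('n)}" for j
    proof -
      have "V_space k \<subseteq> (V_space (j - 1) :: (real ^ ('n perm)) set)"
        using that by (intro V_space_mono) auto
      then show ?thesis
        using that assms by (auto simp: W_space_def orthogonal_comp_def)
    qed
    then show "span (\<Union>j\<in>{k+1..CARD('n)}. W_space j) \<subseteq> orthogonal_comp (V_space k :: (real ^ ('n perm)) set)"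
      by (intro span_minimal subspace_orthogonal_comp UN_least)
  qed
qed (auto simp: subspace_W_space)

theorem theorem39:
  assumes "3 \<le> CARD('n::{finite,linorder})"
  shows "(\<forall>U \<in> insert (V_space 0 :: (real ^ ('n perm)) set) (W_space ` {2..CARD('n)}).
            (\<forall>k\<in>{2..CARD('n) - 1}. R_mat k ` U \<subseteq> U) \<and>
            (\<exists>\<E> \<subseteq> simultaneous_eigenspaces. is_direct_sum \<E> (\<lambda>S. S) U)) \<and>
         (\<forall>k\<in>{2..CARD('n) - 1}.
            is_direct_sum {k+1..CARD('n)} W_space {f :: real ^ ('n perm). R_mat k f = 0})"
proof -
  define K where "K = {2..CARD('n) - 1}"
  interpret commuting_selfadjoint "R_mat :: nat \<Rightarrow> real ^ ('n perm) \<Rightarrow> _" K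
    by (rule commuting_selfadjoint.intro) (auto simp: K_def linear_R_mat R_mat_sym intro: R_mat_commute)
  have KI: "2 \<in> K" "\<And>k. 2 \<le> k \<Longrightarrow> k < CARD('n) \<Longrightarrow> k \<in> K" and K: "\<And>k. k \<in> K \<Longrightarrow> 2 \<le> k \<and> k < CARD('n)"
    using assms by (auto simp: K_def)
  have eig: "eigenspaces = simultaneous_eigenspaces"
    unfolding eigenspaces_def simultaneous_eigenspaces_def K_def[symmetric] eigvec_def
    by (simp add: Collect_ball_eq[symmetric] set_eq_iff)
  have ker: "R_mat k f = 0 \<longleftrightarrow> f \<in> orthogonal_comp (V_space k)" for k and f :: "real ^ ('n perm)"
    using ker_R_mat[of k] by blast
  have V0: "V_space 0 = span {ind_vec UNIV :: real ^ ('n perm)}" by (simp add: V_space_def)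
  have stable: "R_mat k ` U \<subseteq> U"
    if U: "U \<in> insert (V_space 0 :: (real ^ ('n perm)) set) (W_space ` {2..CARD('n)})" and k: "k \<in> K" for U k
  proof -
    have V: "R_mat k ` V_space j \<subseteq> (V_space j :: (real ^ ('n perm)) set)" if "j \<le> CARD('n)" for j
      using that K[OF k] by (intro R_mat_stable_V_space) auto
    have W: "R_mat k ` W_space j \<subseteq> (W_space j :: (real ^ ('n perm)) set)" if "j \<in> {2..CARD('n)}" for j
    proof -
      define i :: nat where "i = (if j = 2 then 0 else j - 1)"
      have "R_mat k ` orthogonal_comp (V_space i) \<subseteq> orthogonal_comp (V_space i :: (real ^ ('n perm)) set)"
        by (intro orthogonal_comp_stable[OF k] V) (use that in \<open>auto simp: i_def\<close>)
      then show ?thesis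
        using V[of j] that unfolding W_space_def i_def[symmetric] by (simp add: image_subset_iff)
    qed
    show ?thesis using U V[of 0] W by (elim insertE imageE) simp_all
  qed
  have in_V: "w \<in> V_space k" if "v \<in> V_space k" "v \<noteq> 0" "eigvec \<mu> v" "eigvec \<mu> w" "k \<in> K" for v w \<mu> k
  proof -
    have "R_mat k v \<noteq> 0" using that(1,2) V_Int_orthogonal_comp ker by blast
    then have "\<mu> k \<noteq> 0" "R_mat k w = \<mu> k *\<^sub>R w" using that by (auto simp: eigvec_def)
    then have "w = inverse (\<mu> k) *\<^sub>R R_mat k w" by simp
    then show ?thesis by (metis R_mat_in_V_space subspace_V_space subspace_scale)
  qed
  have in_comp: "w \<in> orthogonal_comp (V_space k)"
    if "v \<in> orthogonal_comp (V_space k)" "v \<noteq> 0" "eigvec \<mu> v" "eigvec \<mu> w" "k \<in> K" for v w \<mu> k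
    using that ker[of k v] ker[of k w] by (auto simp: eigvec_def)
  have one: "R_mat 2 (ind_vec UNIV) \<in> span {ind_vec UNIV :: real ^ ('n perm)}"
    using R_mat_stable_V_space[of 0 2, where 'n='n] assms by (auto simp: V0 span_base)
  then obtain c where c: "R_mat 2 (ind_vec UNIV) = c *\<^sub>R (ind_vec UNIV :: real ^ ('n perm))"
    by (auto simp: span_singleton)
  have in_V0: "w \<in> V_space 0" if "eigvec \<mu> w" "\<mu> 2 = c" for w \<mu>
    using R_mat_2_constant[OF assms c, of w] that KI(1) by (simp add: eigvec_def)
  \<comment> \<open>The eigenvalues of a common eigenvector tell in which of the subspaces it lies.\<close>
  have whole: "w \<in> U"
    if U: "U \<in> insert (V_space 0 :: (real ^ ('n perm)) set) (W_space ` {2..CARD('n)})"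
      and v: "v \<in> U" "v \<noteq> 0" "eigvec \<mu> v" and w: "eigvec \<mu> w" for U \<mu> v w
  proof -
    consider "U = V_space 0" | "U = W_space 2" | j where "U = W_space j" "3 \<le> j" "j \<le> CARD('n)"
    proof -
      consider "U = V_space 0" | j where "U = W_space j" "2 \<le> j" "j \<le> CARD('n)"
        using U by auto
      then show thesis
      proof cases
        case (2 j)
        then show thesis using that(2) that(3)[of j] by (cases "j = 2") auto
      qed (rule that(1))
    qed
    then show ?thesis
    proof cases
      case 1
      then obtain t where t: "v = t *\<^sub>R ind_vec UNIV" using v(1) by (auto simp: V0 span_singleton)
      have "R_mat 2 v = c *\<^sub>R v"
        by (simp add: t linear_scale[OF linear_R_mat] c mult.commute)
      moreover have "R_mat 2 v = \<mu> 2 *\<^sub>R v"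
        using v(3) KI(1) by (simp add: eigvec_def)
      ultimately show ?thesis using in_V0[OF w] v(2) 1 by simp
    next
      case 2
      then have v': "v \<in> V_space 2" "v \<in> orthogonal_comp (V_space 0)" using v by (auto simp: W_space_def)
      \<comment> \<open>Otherwise \<open>v\<close> would be constant; so \<open>w\<close> belongs to another eigenvalue than the constants.\<close>
      have "\<mu> 2 \<noteq> c" using in_V0[OF v(3)] V_Int_orthogonal_comp v'(2) v(2) by blast
      moreover have "c * (ind_vec UNIV \<bullet> w) = \<mu> 2 * (ind_vec UNIV \<bullet> w)"
        using R_mat_sym[of 2 "ind_vec UNIV" w] w KI(1) c by (simp add: eigvec_def)
      ultimately have "ind_vec UNIV \<bullet> w = 0" by simp
      then have "w \<in> orthogonal_comp (V_space 0)"
        unfolding V0 by (auto simp: orthogonal_comp_def orthogonal_def span_singleton)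
      then show ?thesis using 2 in_V[OF v'(1) v(2,3) w KI(1)] by (simp add: W_space_def)
    next
      case (3 j)
      then have v': "v \<in> V_space j" "v \<in> orthogonal_comp (V_space (j - 1))" using v by (auto simp: W_space_def)
      have "w \<in> orthogonal_comp (V_space (j - 1))"
        using in_comp[OF v'(2) v(2,3) w] KI(2) 3 by simp
      moreover have "w \<in> V_space j"
      proof (cases "j = CARD('n)")
        case False
        then show ?thesis using in_V[OF v'(1) v(2,3) w] KI(2) 3 by simp
      qed (simp add: V_space_CARD)
      ultimately show ?thesis using 3 by (simp add: W_space_def)
    qed
  qed
  show ?thesis
    unfolding K_def[symmetric]
  proof (intro conjI ballI)
    fix U assume U: "U \<in> insert (V_space 0 :: (real ^ ('n perm)) set) (W_space ` {2..CARD('n)})"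
    show "R_mat k ` U \<subseteq> U" if "k \<in> K" for k
      using stable[OF U that] .
    have "subspace U"
      using U subspace_V_space subspace_W_space by auto
    from direct_sum_eigenspaces[OF this stable[OF U] whole[OF U]]
    have "is_direct_sum {S \<in> simultaneous_eigenspaces. S \<subseteq> U} (\<lambda>S. S) U"
      unfolding eig .
    then show "\<exists>\<E>\<subseteq>simultaneous_eigenspaces. is_direct_sum \<E> (\<lambda>S. S) U"
      by (intro exI[of _ "{S \<in> simultaneous_eigenspaces. S \<subseteq> U}"]) auto
  next
    fix k assume "k \<in> K"
    then show "is_direct_sum {k+1..CARD('n)} W_space {f :: real ^ ('n perm). R_mat k f = 0}"
      by (intro ker_R_mat_direct_sum) (auto simp: K_def)
  qed
qed

end
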